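(* For $p\in\mathbb{R}\setminus\{0\}$ let $\mathcal{P}(p)$ be the parabola $y^2=2px+p^2$, and for $E=(x_E,y_E)\in\mathbb{R}^2$ let $\mathcal{D}(E)$ be the unit circle centered at $E$. Put $$\begin{aligned}\mathcal{Q}^7_4(x,y,p)={}&16(x^2+y^2)^3p^4+48x(x^2+y^2)^2(x^2+y^2-1)p^3+4(x^2+y^2)(x^2+y^2-1)^2(13x^2+y^2-1)p^2\\&+4x(x^2+y^2-1)^3(5x^2+y^2-1)p-(x^2+y^2-1)^6,\end{aligned}$$ $$\begin{aligned}\Psi_1(x,y)={}&16(x^2+y^2)^6-x^{10}-71x^8y^2+x^8-247x^6y^4+43x^6y^2-325x^4y^6+108x^4y^4-23x^4y^2\\&-188x^2y^8+91x^2y^6-2x^2y^4+3x^2y^2-40y^{10}+25y^8+5y^6-5y^4-y^2.\end{aligned}$$ Let $\mathcal{R}^1,\mathcal{R}^1_+,\mathcal{R}^1_-$ be the sets of $(x,y)\in\mathbb{R}^2$ with $\Psi_1(x,y)=0$, $>0$, $<0$ respectively; let $S^1,S^1_+,S^1_-$ be the sets with $x^2+y^2-1=0$, $>0$, $<0$ respectively; and let $\Sigma=S^1\cup\{(0,0)\}$. Let $E\in\mathbb{R}^2\setminus\Sigma$. Then: a) If $E\in\mathcal{R}^1_-\cup S^1_+$, there are exactly two parabolas $\mathcal{P}(p)$ such that $(\mathcal{D}(E),\mathcal{P}(p))$ is a $7$-Poncelet pair, corresponding to two distinct real zeros of $\mathcal{Q}^7_4(x_E,y_E,p)\in\mathbb{R}[p]$.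 b) If $E\in\mathcal{R}^1$, there are exactly three such parabolas, corresponding to one real zero of multiplicity $2$ and two real zeros of multiplicity $1$ of $\mathcal{Q}^7_4(x_E,y_E,p)$. c) If $E\in\mathcal{R}^1_+\cap S^1_-$, there are exactly four such parabolas, corresponding to four distinct real zeros of $\mathcal{Q}^7_4(x_E,y_E,p)$.
   Context: Real conics are identified with their complexifications in $\mathbb{CP}^2$, and polygons are taken in $\mathbb{CP}^2$ (vertices and sides may be non-real). For $n\ge 3$ and two smooth conics $\mathcal{C}_1,\mathcal{C}_2$, an $n$-Poncelet polygon is an $n$-gon ($n$ distinct vertices, $n$ distinct side lines) whose vertices lie on $\mathcal{C}_1$ and whose side lines are tangent to $\mathcal{C}_2$; a $k$-gon traversed $m>1$ times is not regarded as an $mk$-gon. The pair $(\mathcal{C}_1,\mathcal{C}_2)$ is an $n$-Poncelet pair if such an $n$-gon exists. *)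

theory Defs
  imports "HOL-Analysis.Analysis" "HOL-Computational_Algebra.Polynomial"
begin

section \<open>The complex projective plane\<close>

definition proportional :: "complex^3 \<Rightarrow> complex^3 \<Rightarrow> bool" where
  "proportional u v \<longleftrightarrow> u \<noteq> 0 \<and> v \<noteq> 0 \<and> (\<exists>c. c \<noteq> 0 \<and> v = c *s u)"

quotient_type cp2 = "complex^3" / partial: proportional
proof (rule part_equivpI)
  have "proportional (axis 1 1) (axis 1 1)"
    unfolding proportional_def by (auto intro!: exI[of _ 1] simp: axis_eq_0_iff)
  then show "\<exists>u. proportional u u" ..
  show "symp proportional"
  proof (rule sympI)
    fix u v assume "proportional u v"
    then obtain c where c: "u \<noteq> 0" "v \<noteq> 0" "c \<noteq> 0" "v = c *s u"
      unfolding proportional_def by blast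
    then have "u = inverse c *s v" by (simp add: vector_smult_assoc)
    with c show "proportional v u"
      unfolding proportional_def by (metis inverse_nonzero_iff_nonzero)
  qed
  show "transp proportional"
  proof (rule transpI)
    fix u v w assume "proportional u v" "proportional v w"
    then obtain c d where "u \<noteq> 0" "w \<noteq> 0" "c \<noteq> 0" "d \<noteq> 0" "w = d *s (c *s u)"
      unfolding proportional_def by blast
    then show "proportional u w"
      unfolding proportional_def by (auto simp: vector_smult_assoc intro!: exI[of _ "d * c"])
  qed
qed

text \<open>The bilinear (not sesquilinear) pairing on \<open>complex^3\<close>; the class operation
  \<open>inner\<close> on this type is real-valued.\<close>

definition pairing :: "complex^3 \<Rightarrow> complex^3 \<Rightarrow> complex" where
  "pairing u v = (\<Sum>i\<in>UNIV. u $ i * v $ i)"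

lemma pairing_scale [simp]:
  "pairing (c *s u) v = c * pairing u v" "pairing u (c *s v) = c * pairing u v"
  by (simp_all add: pairing_def sum_distrib_left mult_ac)

lemma matrix_vector_scale: "A *v (c *s u) = c *s (A *v u)" for A :: "complex^3^3"
  by (simp add: vec_eq_iff matrix_vector_mult_def sum_distrib_left mult_ac)

lift_definition incident :: "complex^3 \<Rightarrow> cp2 \<Rightarrow> bool" is "\<lambda>a u. pairing a u = 0"
  by (auto simp: proportional_def)

definition proj_line :: "complex^3 \<Rightarrow> cp2 set" where
  "proj_line a = {P. incident a P}"

definition is_line :: "cp2 set \<Rightarrow> bool" where
  "is_line l \<longleftrightarrow> (\<exists>a. a \<noteq> 0 \<and> l = proj_line a)"

section \<open>Conics\<close>

text \<open>A conic is given by a symmetric matrix \<open>A\<close>, through the equation \<open>u\<^sup>T A u = 0\<close> in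
  homogeneous coordinates \<open>u\<close>.\<close>

lift_definition on_conic :: "complex^3^3 \<Rightarrow> cp2 \<Rightarrow> bool" is "\<lambda>A u. pairing u (A *v u) = 0"
  by (auto simp: proportional_def matrix_vector_scale)

definition conic_points :: "complex^3^3 \<Rightarrow> cp2 set" where
  "conic_points A = {P. on_conic A P}"

definition smooth_conic :: "complex^3^3 \<Rightarrow> bool" where
  "smooth_conic A \<longleftrightarrow> transpose A = A \<and> det A \<noteq> 0"

text \<open>The gradient of the quadratic form of \<open>A\<close> at \<open>u\<close> is \<open>2 A u\<close>, so for a point \<open>[u]\<close> of a
  smooth conic the following is the tangent line at \<open>[u]\<close>.\<close>

lift_definition tangent_line_at :: "complex^3^3 \<Rightarrow> cp2 \<Rightarrow> cp2 set" is
  "\<lambda>A u. proj_line (A *v u)"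
proof -
  fix A :: "complex^3^3" and u v
  assume "proportional u v"
  then obtain c where c: "c \<noteq> 0" "v = c *s u" unfolding proportional_def by blast
  have "incident (c *s a) P = incident a P" for a P
    using c(1) by transfer simp
  then show "proj_line (A *v u) = proj_line (A *v v)"
    by (simp add: proj_line_def c matrix_vector_scale)
qed

definition tangent_to_conic :: "cp2 set \<Rightarrow> complex^3^3 \<Rightarrow> bool" where
  "tangent_to_conic l A \<longleftrightarrow> (\<exists>P \<in> conic_points A. l = tangent_line_at A P)"

section \<open>Poncelet polygons\<close>

text \<open>The polygon has vertices \<open>v 0, \<dots>, v (n - 1)\<close>; its \<open>i\<close>-th side line \<open>l i\<close> joins
  \<open>v i\<close> to \<open>v (i + 1)\<close>, indices being taken modulo \<open>n\<close>.\<close>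

definition poncelet_polygon ::
  "nat \<Rightarrow> complex^3^3 \<Rightarrow> complex^3^3 \<Rightarrow> (nat \<Rightarrow> cp2) \<Rightarrow> (nat \<Rightarrow> cp2 set) \<Rightarrow> bool" where
  "poncelet_polygon n A B v l \<longleftrightarrow>
     inj_on v {..<n} \<and> inj_on l {..<n} \<and>
     (\<forall>i<n. is_line (l i) \<and> v i \<in> l i \<and> v (Suc i mod n) \<in> l i \<and>
            v i \<in> conic_points A \<and> tangent_to_conic (l i) B)"

definition poncelet_pair :: "nat \<Rightarrow> complex^3^3 \<Rightarrow> complex^3^3 \<Rightarrow> bool" where
  "poncelet_pair n A B \<longleftrightarrow>
     n \<ge> 3 \<and> smooth_conic A \<and> smooth_conic B \<and> (\<exists>v l. poncelet_polygon n A B v l)"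

section \<open>The circles and the parabolas\<close>

text \<open>Homogeneous coordinates are \<open>[x : y : z]\<close>, the affine part of the plane being \<open>z = 1\<close>.
  The matrices below are those of
  \<open>(x - x\<^sub>E z)\<^sup>2 + (y - y\<^sub>E z)\<^sup>2 = z\<^sup>2\<close> and of \<open>y\<^sup>2 = 2 p x z + p\<^sup>2 z\<^sup>2\<close>;
  the lemmas that follow confirm their real affine points.\<close>

definition complexify :: "real^3^3 \<Rightarrow> complex^3^3" where
  "complexify M = (\<chi> i j. complex_of_real (M $ i $ j))"

definition unit_circle :: "real \<times> real \<Rightarrow> complex^3^3" where
  "unit_circle E = complexify (vector
     [vector [1, 0, - fst E],
      vector [0, 1, - snd E],
      vector [- fst E, - snd E, (fst E)\<^sup>2 + (snd E)\<^sup>2 - 1]])"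

definition parabola :: "real \<Rightarrow> complex^3^3" where
  "parabola p = complexify (vector
     [vector [0, 0, - p],
      vector [0, 1, 0],
      vector [- p, 0, - p\<^sup>2]])"

definition affine_point :: "real \<times> real \<Rightarrow> cp2" where
  "affine_point X = abs_cp2 (vector [complex_of_real (fst X), complex_of_real (snd X), 1])"

lemma on_conic_affine_point:
  "on_conic A (affine_point (x, y)) \<longleftrightarrow>
     pairing (vector [complex_of_real x, complex_of_real y, 1])
       (A *v vector [complex_of_real x, complex_of_real y, 1]) = 0"
proof -
  let ?u = "vector [complex_of_real x, complex_of_real y, 1] :: complex^3"
  have "?u $ 3 \<noteq> 0" by simp
  then have "?u \<noteq> 0" by (metis zero_index)
  then have "proportional ?u ?u"
    unfolding proportional_def by (auto intro!: exI[of _ 1])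
  then show ?thesis
    unfolding affine_point_def by (simp add: on_conic.abs_eq)
qed

lemma affine_point_in_parabola:
  "affine_point (x, y) \<in> conic_points (parabola p) \<longleftrightarrow> y\<^sup>2 = 2 * p * x + p\<^sup>2"
proof -
  have "affine_point (x, y) \<in> conic_points (parabola p) \<longleftrightarrow>
          complex_of_real (y\<^sup>2 - (2 * p * x + p\<^sup>2)) = 0"
    by (simp add: conic_points_def on_conic_affine_point pairing_def matrix_vector_mult_def
        sum_3 parabola_def complexify_def algebra_simps power2_eq_square)
  then show ?thesis by (simp only: of_real_eq_0_iff) simp
qed

lemma affine_point_in_unit_circle:
  "affine_point (x, y) \<in> conic_points (unit_circle E) \<longleftrightarrow> dist (x, y) E = 1"
proof -
  have "affine_point (x, y) \<in> conic_points (unit_circle E) \<longleftrightarrow>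
          complex_of_real ((x - fst E)\<^sup>2 + (y - snd E)\<^sup>2 - 1) = 0"
    by (simp add: conic_points_def on_conic_affine_point pairing_def matrix_vector_mult_def
        sum_3 unit_circle_def complexify_def algebra_simps power2_eq_square)
  then show ?thesis
    by (simp only: of_real_eq_0_iff) (cases E, simp add: dist_prod_def dist_real_def)
qed

lemma smooth_conic_unit_circle: "smooth_conic (unit_circle E)"
proof -
  have "det (unit_circle E) = - 1"
    by (simp add: det_3 unit_circle_def complexify_def algebra_simps power2_eq_square)
  then show ?thesis
    by (simp add: smooth_conic_def)
      (simp add: vec_eq_iff transpose_def unit_circle_def complexify_def forall_3)
qed

lemma smooth_conic_parabola: "p \<noteq> 0 \<Longrightarrow> smooth_conic (parabola p)"
proof -
  assume "p \<noteq> 0"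
  moreover have "det (parabola p) = - (complex_of_real p)\<^sup>2"
    by (simp add: det_3 parabola_def complexify_def algebra_simps power2_eq_square)
  ultimately show ?thesis
    by (simp add: smooth_conic_def)
      (simp add: vec_eq_iff transpose_def parabola_def complexify_def forall_3)
qed

definition poncelet_parameters :: "nat \<Rightarrow> real \<times> real \<Rightarrow> real set" where
  "poncelet_parameters n E = {p. p \<noteq> 0 \<and> poncelet_pair n (unit_circle E) (parabola p)}"

definition poncelet_parabolas :: "nat \<Rightarrow> real \<times> real \<Rightarrow> cp2 set set" where
  "poncelet_parabolas n E = (\<lambda>p. conic_points (parabola p)) ` poncelet_parameters n E"

section \<open>The polynomials and the regions\<close>

definition Q7_4 :: "real \<Rightarrow> real \<Rightarrow> real poly" where
  "Q7_4 x y =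
     monom (16 * (x^2 + y^2)^3) 4
   + monom (48 * x * (x^2 + y^2)^2 * (x^2 + y^2 - 1)) 3
   + monom (4 * (x^2 + y^2) * (x^2 + y^2 - 1)^2 * (13 * x^2 + y^2 - 1)) 2
   + monom (4 * x * (x^2 + y^2 - 1)^3 * (5 * x^2 + y^2 - 1)) 1
   - monom ((x^2 + y^2 - 1)^6) 0"

definition Psi_1 :: "real \<Rightarrow> real \<Rightarrow> real" where
  "Psi_1 x y =
     16 * (x^2 + y^2)^6 - x^10 - 71 * x^8 * y^2 + x^8 - 247 * x^6 * y^4 + 43 * x^6 * y^2
   - 325 * x^4 * y^6 + 108 * x^4 * y^4 - 23 * x^4 * y^2 - 188 * x^2 * y^8 + 91 * x^2 * y^6
   - 2 * x^2 * y^4 + 3 * x^2 * y^2 - 40 * y^10 + 25 * y^8 + 5 * y^6 - 5 * y^4 - y^2"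

definition R1 :: "(real \<times> real) set" where
  "R1 = {(x, y). Psi_1 x y = 0}"

definition R1_plus :: "(real \<times> real) set" where
  "R1_plus = {(x, y). Psi_1 x y > 0}"

definition R1_minus :: "(real \<times> real) set" where
  "R1_minus = {(x, y). Psi_1 x y < 0}"

definition S1 :: "(real \<times> real) set" where
  "S1 = {(x, y). x^2 + y^2 - 1 = 0}"

definition S1_plus :: "(real \<times> real) set" where
  "S1_plus = {(x, y). x^2 + y^2 - 1 > 0}"

definition S1_minus :: "(real \<times> real) set" where
  "S1_minus = {(x, y). x^2 + y^2 - 1 < 0}"

definition Sigma1 :: "(real \<times> real) set" where
  "Sigma1 = S1 \<union> {(0, 0)}"

end

(* A tangent line of the parabola is a point (U : V) of the projective line, chosen so that two tangents
   meet at the point with x + i y = U U', x - i y = V V' and z = mu (U - V) (U' - V'), mu = -1 / (2 p).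
   "The meeting point lies on the circle" becomes a symmetric biquadratic correspondence F, and a
   Poncelet 7-gon is a cyclic chain of 7 distinct consecutive F-related points.

   One chain is explicit: it starts with the line at infinity (1 : 1), whose neighbours (1 : 0) and
   (0 : 1) come from the circular points; it returns after 7 steps iff Q7_4 vanishes at p. If it
   returns, complex conjugation, which reflects the chain, forces its 7 members to be distinct, so it is
   itself a Poncelet 7-gon. Conversely, a porism argument transports closing from any Poncelet 7-gon to
   this chain: two cross-ratio-like quantities of a pair of chains are invariant under shifts, and
   after 7 steps they yield a quartic equation with 7 distinct roots, which must vanish identically.

   With u = 2 x + 2 (x^2 + y^2) p / k and k = x^2 + y^2 - 1, the polynomial Q7_4 becomes, up to a factor,
   u (u - 2 x) (u^2 + k) - k^2 (k + 1), which is negative at 0 and has discriminant -16 k^3 Psi_1 and no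
   triple root; this counts its real roots. *)

theory Submission
  imports Defs
begin

section \<open>Chains of a symmetric biquadratic correspondence\<close>

text \<open>All the parabolas have their focus at (0, 0), so the isotropic lines x + i y = 0 and x -
  i y = 0 and the line at infinity are tangent to each of them; these are (0 : 1), (1 : 0) and (1 :
  1). The line at infinity meets the other two in the circular points, which lie on every circle.
  This is why one chain is known explicitly, with three members independent of p, and why
  conjugation reflects it.

  The classical porism uses the group law on the curve F = 0. The circle and the parabola may touch,
  so that curve may be singular, and nothing relates the given polygon to the explicit chain.
  Polynomial identities between neighbouring members of two chains replace the group law.

  The quantity u comes from the chain: with c = mu^2 k, the number \<open>\<nu>\<close> occurring in
  \<open>P2\<close> and \<open>M2\<close> equals mu^3 k u. Eliminating mu from
  \<open>closing\<close> by u - 2 x = - (x^2 + y^2) / (mu k) leaves the quartic in u. The two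
  denominators are nonzero exactly because E is not in Sigma.\<close>

type_synonym hom_pair = "complex \<times> complex"

definition bracket :: "hom_pair \<Rightarrow> hom_pair \<Rightarrow> complex" where
  "bracket T S = fst T * snd S - snd T * fst S"

lemma bracket_commute: "bracket T S = - bracket S T"
  by (simp add: bracket_def)

lemma bracket_eq_0_commute: "bracket T S = 0 \<longleftrightarrow> bracket S T = 0"
  by (auto simp: bracket_commute[of T S])

lemma bracket_self [simp]: "bracket T T = 0"
  by (simp add: bracket_def)

lemma bracket_eq_0_scale:
  assumes "bracket T S = 0" "T \<noteq> 0" "S \<noteq> 0"
  obtains k where "k \<noteq> 0" "S = (k * fst T, k * snd T)"
proof (cases "fst T = 0")
  case True
  with assms have "snd T \<noteq> 0" by (auto simp: prod_eq_iff)
  with True assms show ?thesis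
    by (intro that[of "snd S / snd T"]) (auto simp: bracket_def prod_eq_iff)
next
  case False
  with assms show ?thesis
    by (intro that[of "fst S / fst T"]) (auto simp: bracket_def prod_eq_iff field_simps)
qed

lemma bracket_eq_0_trans:
  assumes "bracket T S = 0" "bracket S R = 0" "S \<noteq> 0"
  shows "bracket T R = 0"
proof -
  have "fst S * bracket T R = 0" "snd S * bracket T R = 0"
    using assms(1,2) unfolding bracket_def by algebra+
  with assms(3) show ?thesis by (auto simp: prod_eq_iff)
qed

text \<open>Conjugating x and y turns x + i y into the conjugate of x - i y, so in tangent
  parameters the real structure also exchanges the two components.\<close>

definition conj_swap :: "hom_pair \<Rightarrow> hom_pair" where
  "conj_swap T = (cnj (snd T), cnj (fst T))"

lemma bracket_conj_swap_eq_0: "bracket (conj_swap T) (conj_swap S) = 0 \<longleftrightarrow> bracket T S = 0"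
proof -
  have "bracket (conj_swap T) (conj_swap S) = - cnj (bracket T S)"
    by (simp add: bracket_def conj_swap_def)
  then show ?thesis by simp
qed

text \<open>The parameters encode the circle \<open>(X - \<alpha> Z) (Y - \<beta> Z) = (\<alpha> \<beta> - c) Z\<^sup>2\<close> in the coordinates
  \<open>X = U U'\<close>, \<open>Y = V V'\<close>, \<open>Z = (U - V) (U' - V')\<close> of the intersection of two tangents of the parabola.\<close>

locale tangent_pencil =
  fixes \<alpha> \<beta> c :: complex
  assumes cnj_\<alpha>: "cnj \<alpha> = \<beta>" and cnj_c: "cnj c = c" and c_nz: "c \<noteq> 0"
    and \<delta>_nz: "\<alpha> * \<beta> \<noteq> c"
begin

lemma cnj_\<beta>: "cnj \<beta> = \<alpha>"
  using cnj_\<alpha> by auto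

definition f2 :: "hom_pair \<Rightarrow> complex" where
  "f2 T = (fst T - snd T) * (c * (fst T - snd T) - \<beta> * fst T)"

definition f1 :: "hom_pair \<Rightarrow> complex" where
  "f1 T = fst T * snd T - \<alpha> * (fst T - snd T) * snd T + \<beta> * (fst T - snd T) * fst T
     - 2 * c * (fst T - snd T)^2"

definition f0 :: "hom_pair \<Rightarrow> complex" where
  "f0 T = (fst T - snd T) * (\<alpha> * snd T + c * (fst T - snd T))"

lemmas f_defs = f2_def f1_def f0_def

definition F :: "hom_pair \<Rightarrow> hom_pair \<Rightarrow> complex" where
  "F T W = f2 T * (fst W)^2 + f1 T * fst W * snd W + f0 T * (snd W)^2"

lemma F_commute: "F T S = F S T"
  unfolding F_def f_defs by (simp add: algebra_simps power2_eq_square)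

text \<open>If the outer forms vanish and the components of \<open>T\<close> differ,
  \<open>f1\<close> collapses to \<open>fst T * snd T\<close>. Hence every tangent has exactly two
  neighbours, counted with multiplicity.\<close>

lemma form_nonzero:
  assumes "T \<noteq> 0" "f2 T = 0" "f1 T = 0" "f0 T = 0"
  shows False
proof (cases "fst T = snd T")
  case True
  with assms show ?thesis by (auto simp: f_defs prod_eq_iff)
next
  case False
  then have *: "c * (fst T - snd T) = \<beta> * fst T" "\<alpha> * snd T = - c * (fst T - snd T)"
    using assms by (auto simp: f_defs add_eq_0_iff)
  then have "fst T * snd T = 0"
    using assms(3) unfolding f_defs by algebra
  with * assms(1) False c_nz show ?thesis by (auto simp: prod_eq_iff)
qed

text \<open>\<open>S\<close> and \<open>R\<close> are the two neighbours of \<open>T\<close>, that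
  is, the roots of the binary quadratic \<open>F T\<close>. Comparing coefficients up to a factor
  also covers a double root and roots with a zero component.\<close>

definition vieta :: "hom_pair \<Rightarrow> hom_pair \<Rightarrow> hom_pair \<Rightarrow> bool" where
  "vieta S T R \<longleftrightarrow> S \<noteq> 0 \<and> T \<noteq> 0 \<and> R \<noteq> 0 \<and>
     (\<exists>l. l \<noteq> 0 \<and> f2 T = l * (snd S * snd R) \<and>
        f1 T = - l * (fst S * snd R + snd S * fst R) \<and> f0 T = l * (fst S * fst R))"

lemma vieta_nz: "vieta S T R \<Longrightarrow> S \<noteq> 0 \<and> T \<noteq> 0 \<and> R \<noteq> 0"
  by (simp add: vieta_def)

lemma vieta_commute: "vieta S T R \<longleftrightarrow> vieta R T S"
  unfolding vieta_def by (auto simp: algebra_simps)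

lemma vieta_F:
  assumes "vieta S T R"
  obtains l where "l \<noteq> 0" "\<And>W. F T W = l * bracket W S * bracket W R"
proof -
  from assms obtain l where l: "l \<noteq> 0" "f2 T = l * (snd S * snd R)"
    "f1 T = - l * (fst S * snd R + snd S * fst R)" "f0 T = l * (fst S * fst R)"
    unfolding vieta_def by blast
  have "F T W = l * bracket W S * bracket W R" for W
    unfolding F_def bracket_def l(2-4) by (simp add: algebra_simps power2_eq_square)
  with l(1) show ?thesis by (rule that)
qed

lemma vieta_root_iff:
  assumes "vieta S T R"
  shows "F T W = 0 \<longleftrightarrow> bracket W S = 0 \<or> bracket W R = 0"
  using vieta_F[OF assms] by (metis mult_eq_0_iff)

lemma F_scale: "F (k * fst T, k * snd T) W = k^2 * F T W"
  unfolding F_def f_defs by (simp add: algebra_simps power2_eq_square)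

lemma F_cong:
  assumes "bracket T T' = 0" "T \<noteq> 0" "T' \<noteq> 0"
  shows "F T W = 0 \<longleftrightarrow> F T' W = 0"
  using bracket_eq_0_scale[OF assms] F_scale by (metis mult_eq_0_iff power_not_zero)

lemma vieta_scale:
  assumes "vieta S T R" "k \<noteq> 0"
  shows "vieta S T (k * fst R, k * snd R)" "vieta S (k * fst T, k * snd T) R"
proof -
  from assms obtain l where l: "l \<noteq> 0" "f2 T = l * (snd S * snd R)"
    "f1 T = - l * (fst S * snd R + snd S * fst R)" "f0 T = l * (fst S * fst R)"
    unfolding vieta_def by blast
  have nz: "S \<noteq> 0" "T \<noteq> 0" "R \<noteq> 0" "(k * fst R, k * snd R) \<noteq> 0" "(k * fst T, k * snd T) \<noteq> 0"
    using vieta_nz[OF assms(1)] assms(2) by (auto simp: prod_eq_iff)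
  show "vieta S T (k * fst R, k * snd R)"
    unfolding vieta_def using nz l assms(2)
    by (intro conjI exI[of _ "l / k"]) (simp_all add: distrib_left)
  have "f2 (k * fst T, k * snd T) = k^2 * f2 T" "f1 (k * fst T, k * snd T) = k^2 * f1 T"
    "f0 (k * fst T, k * snd T) = k^2 * f0 T"
    unfolding f_defs by (simp_all add: algebra_simps power2_eq_square)
  then show "vieta S (k * fst T, k * snd T) R"
    unfolding vieta_def using nz l assms(2)
    by (intro conjI exI[of _ "k^2 * l"]) auto
qed

lemma vieta_cong:
  assumes "vieta S T R" "bracket S S' = 0" "bracket T T' = 0" "bracket R R' = 0"
    "S' \<noteq> 0" "T' \<noteq> 0" "R' \<noteq> 0"
  shows "vieta S' T' R'"
proof -
  have nz: "S \<noteq> 0" "T \<noteq> 0" "R \<noteq> 0" using vieta_nz[OF assms(1)] by auto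
  have "vieta S T R'"
    using bracket_eq_0_scale[OF assms(4) nz(3) assms(7)] vieta_scale(1)[OF assms(1)] by metis
  then have "vieta S T' R'"
    using bracket_eq_0_scale[OF assms(3) nz(2) assms(6)] vieta_scale(2) by metis
  then show ?thesis
    using bracket_eq_0_scale[OF assms(2) nz(1) assms(5)] vieta_scale(1) vieta_commute by metis
qed

lemma vieta_exists:
  assumes "S \<noteq> 0" "T \<noteq> 0" "F T S = 0"
  obtains R where "vieta S T R"
proof -
  obtain R where R: "f2 T = snd S * snd R" "f1 T = - (fst S * snd R + snd S * fst R)"
    "f0 T = fst S * fst R"
  proof (cases "fst S = 0")
    case True
    with assms have "snd S \<noteq> 0" by (auto simp: prod_eq_iff)
    with True assms(3) show ?thesis
      by (intro that[of "(- f1 T / snd S, f2 T / snd S)"]) (auto simp: F_def)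
  next
    case False
    have "f2 T = - (snd S * (f1 T * fst S + snd S * f0 T)) / (fst S)^2"
      using assms(3) False unfolding F_def
      by (simp add: field_simps power2_eq_square) algebra
    with False show ?thesis
      by (intro that[of "(f0 T / fst S, - (f1 T + snd S * (f0 T / fst S)) / fst S)"])
        (auto simp: field_simps power2_eq_square)
  qed
  moreover have "R \<noteq> 0"
    using R form_nonzero[OF assms(2)] by auto
  ultimately show ?thesis
    using assms by (intro that[of R]) (auto simp: vieta_def intro!: exI[of _ 1])
qed

lemma vieta_of_distinct_roots:
  assumes "S \<noteq> 0" "T \<noteq> 0" "R \<noteq> 0" "F T S = 0" "F T R = 0" "bracket S R \<noteq> 0"
  shows "vieta S T R"
proof -
  obtain R' where R': "vieta S T R'" using vieta_exists assms by blast
  then have "bracket R' R = 0"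
    using vieta_root_iff[OF R'] assms(5,6) bracket_eq_0_commute by blast
  with R' assms show ?thesis by (intro vieta_cong[OF R']) auto
qed

text \<open>The ratio of the outer coefficients is the product of the two roots, and this fixes the
  second root once the first is neither zero nor infinite.\<close>

lemma vieta_of_ratio:
  assumes "S \<noteq> 0" "T \<noteq> 0" "R \<noteq> 0" "F T S = 0" "fst S \<noteq> 0" "snd S \<noteq> 0"
    "f0 T * snd S * snd R = f2 T * fst S * fst R"
  shows "vieta S T R"
proof -
  obtain R' where R': "vieta S T R'" using vieta_exists assms by blast
  then obtain l where "l \<noteq> 0" "f2 T = l * (snd S * snd R')" "f0 T = l * (fst S * fst R')"
    unfolding vieta_def by blast
  then have "l * fst S * snd S * bracket R' R = 0"
    using assms(7) unfolding bracket_def by (simp add: algebra_simps)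
  then have "bracket R' R = 0" using \<open>l \<noteq> 0\<close> assms by simp
  with R' assms show ?thesis by (intro vieta_cong[OF R']) auto
qed

text \<open>Two consecutive members determine a chain up to scaling. Each factorization is tested at
  the other's root, which settles the case of a double root as well.\<close>

lemma vieta_unique:
  assumes "vieta S T R" "vieta S' T' R'" "bracket S S' = 0" "bracket T T' = 0"
  shows "bracket R R' = 0"
proof -
  have nz: "S \<noteq> 0" "T \<noteq> 0" "R \<noteq> 0" "S' \<noteq> 0" "T' \<noteq> 0" "R' \<noteq> 0"
    using vieta_nz[OF assms(1)] vieta_nz[OF assms(2)] by auto
  have v: "vieta S T R'"
    by (rule vieta_cong[OF assms(2)]) (use nz assms(3,4) bracket_eq_0_commute in auto)
  obtain l where l: "l \<noteq> 0" "\<And>W. F T W = l * bracket W S * bracket W R" using vieta_F[OF assms(1)] by blast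
  obtain m where m: "m \<noteq> 0" "\<And>W. F T W = m * bracket W S * bracket W R'" using vieta_F[OF v] by blast
  have a: "bracket R S = 0 \<or> bracket R R' = 0" using l(2)[of R] m by simp
  have b: "bracket R' S = 0 \<or> bracket R' R = 0" using m(2)[of R'] l by simp
  show ?thesis
    using a b nz bracket_eq_0_trans[of R S R'] bracket_eq_0_commute by metis
qed

lemma vieta_conj_swap:
  assumes "vieta S T R"
  shows "vieta (conj_swap S) (conj_swap T) (conj_swap R)"
proof -
  from assms obtain l where l: "l \<noteq> 0" "f2 T = l * (snd S * snd R)"
    "f1 T = - l * (fst S * snd R + snd S * fst R)" "f0 T = l * (fst S * fst R)"
    unfolding vieta_def by blast
  have "f2 (conj_swap T) = cnj (f0 T)" "f0 (conj_swap T) = cnj (f2 T)"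
    "f1 (conj_swap T) = cnj (f1 T)"
    unfolding f_defs conj_swap_def
    by (simp_all add: cnj_\<alpha> cnj_\<beta> cnj_c algebra_simps power2_eq_square)
  moreover have "conj_swap S \<noteq> 0" "conj_swap T \<noteq> 0" "conj_swap R \<noteq> 0"
    using vieta_nz[OF assms] by (auto simp: conj_swap_def prod_eq_iff)
  ultimately show ?thesis
    unfolding vieta_def using l
    by (intro conjI exI[of _ "cnj l"]) (auto simp: conj_swap_def algebra_simps)
qed

text \<open>Twice the polarization of the circle equation, evaluated at two intersections of tangents.\<close>

definition G :: "hom_pair \<Rightarrow> hom_pair \<Rightarrow> hom_pair \<Rightarrow> hom_pair \<Rightarrow> complex" where
  "G T T' S S' =
     (let X = fst T * fst T'; Y = snd T * snd T'; Z = (fst T - snd T) * (fst T' - snd T');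
          x = fst S * fst S'; y = snd S * snd S'; z = (fst S - snd S) * (fst S' - snd S')
      in X * y + Y * x - Z * (\<alpha> * y + \<beta> * x) - z * (\<alpha> * Y + \<beta> * X) + 2 * c * Z * z)"

lemma G_commute: "G T T' S S' = G T' T S S'" "G T T' S S' = G T T' S' S"
  by (simp_all add: G_def Let_def algebra_simps)

definition sym_part :: "hom_pair \<Rightarrow> hom_pair \<Rightarrow> hom_pair \<Rightarrow> hom_pair \<Rightarrow> complex" where
  "sym_part T\<^sub>1 S\<^sub>1 T\<^sub>0 T\<^sub>2 =
     bracket T\<^sub>0 S\<^sub>1 * (snd T\<^sub>1 * G T\<^sub>1 T\<^sub>2 S\<^sub>1 (0, 1) + fst T\<^sub>1 * G T\<^sub>1 T\<^sub>2 S\<^sub>1 (1, 0))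
   + bracket T\<^sub>2 S\<^sub>1 * (snd T\<^sub>1 * G T\<^sub>1 T\<^sub>0 S\<^sub>1 (0, 1) + fst T\<^sub>1 * G T\<^sub>1 T\<^sub>0 S\<^sub>1 (1, 0))"

text \<open>A symmetric bilinear expression in the two neighbours of \<open>T\<^sub>1\<close>
  depends only on the coefficients of the quadratic having them as roots. Those are the forms at
  \<open>T\<^sub>1\<close>, so the claim becomes a polynomial identity in \<open>T\<^sub>1\<close>
  and \<open>S\<^sub>1\<close>.\<close>

lemma sym_part_eq_0:
  assumes "vieta T\<^sub>0 T\<^sub>1 T\<^sub>2"
  shows "sym_part T\<^sub>1 S\<^sub>1 T\<^sub>0 T\<^sub>2 = 0"
proof -
  from assms obtain l where l: "l \<noteq> 0" "f2 T\<^sub>1 = l * (snd T\<^sub>0 * snd T\<^sub>2)"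
    "f1 T\<^sub>1 = - l * (fst T\<^sub>0 * snd T\<^sub>2 + snd T\<^sub>0 * fst T\<^sub>2)" "f0 T\<^sub>1 = l * (fst T\<^sub>0 * fst T\<^sub>2)"
    unfolding vieta_def by blast
  let ?K = "sym_part T\<^sub>1 S\<^sub>1"
  have "?K T\<^sub>0 T\<^sub>2 = ?K (1, 0) (1, 0) * (fst T\<^sub>0 * fst T\<^sub>2)
      + ?K (1, 0) (0, 1) * (fst T\<^sub>0 * snd T\<^sub>2 + snd T\<^sub>0 * fst T\<^sub>2) + ?K (0, 1) (0, 1) * (snd T\<^sub>0 * snd T\<^sub>2)"
    unfolding sym_part_def G_def Let_def bracket_def fst_conv snd_conv by algebra
  then have "l * ?K T\<^sub>0 T\<^sub>2 = ?K (1, 0) (1, 0) * f0 T\<^sub>1 - ?K (1, 0) (0, 1) * f1 T\<^sub>1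
      + ?K (0, 1) (0, 1) * f2 T\<^sub>1"
    unfolding l(2-4) by (simp add: algebra_simps)
  also have "\<dots> = 0"
    unfolding sym_part_def G_def Let_def bracket_def f_defs fst_conv snd_conv by algebra
  finally show ?thesis using l(1) by simp
qed

text \<open>Splitting bilinear expressions into symmetric and antisymmetric parts in the pairs \<open>T\<^sub>0, T\<^sub>2\<close> and
  \<open>S\<^sub>0, S\<^sub>2\<close> reduces the difference of the two sides to two terms containing \<open>sym_part\<close>.\<close>

lemma chain_invariance:
  assumes "vieta T\<^sub>0 T\<^sub>1 T\<^sub>2" "vieta S\<^sub>0 S\<^sub>1 S\<^sub>2"
  shows "bracket T\<^sub>0 S\<^sub>1 * bracket S\<^sub>0 T\<^sub>1 * G T\<^sub>1 T\<^sub>2 S\<^sub>1 S\<^sub>2 = bracket T\<^sub>2 S\<^sub>1 * bracket S\<^sub>2 T\<^sub>1 * G T\<^sub>0 T\<^sub>1 S\<^sub>0 S\<^sub>1"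
proof -
  have "2 * (bracket T\<^sub>0 S\<^sub>1 * bracket S\<^sub>0 T\<^sub>1 * G T\<^sub>1 T\<^sub>2 S\<^sub>1 S\<^sub>2 - bracket T\<^sub>2 S\<^sub>1 * bracket S\<^sub>2 T\<^sub>1 * G T\<^sub>0 T\<^sub>1 S\<^sub>0 S\<^sub>1)
      = bracket S\<^sub>0 S\<^sub>2 * sym_part T\<^sub>1 S\<^sub>1 T\<^sub>0 T\<^sub>2 + bracket T\<^sub>0 T\<^sub>2 * sym_part S\<^sub>1 T\<^sub>1 S\<^sub>0 S\<^sub>2"
    unfolding sym_part_def G_def Let_def bracket_def fst_conv snd_conv by algebra
  then show ?thesis
    using sym_part_eq_0[OF assms(1)] sym_part_eq_0[OF assms(2)] by simp
qed

section \<open>The explicit chain through the line at infinity, and when it closes\<close>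

definition \<nu> :: complex where
  "\<nu> = \<alpha> * c + \<beta> * c - \<alpha> * \<beta>"

text \<open>The chain through the line at infinity is \<open>M2, M1, (0, 1), (1, 1), (1, 0), P1, P2\<close>.\<close>

definition P1 :: hom_pair where "P1 = (c, c - \<beta>)"
definition P2 :: hom_pair where "P2 = (- \<beta> * \<nu>, c * (c - \<beta>) - \<beta> * \<nu>)"
definition M1 :: hom_pair where "M1 = (c - \<alpha>, c)"
definition M2 :: hom_pair where "M2 = (c * (c - \<alpha>) - \<alpha> * \<nu>, - \<alpha> * \<nu>)"

lemma conj_swap_special [simp]:
  "conj_swap (0, 1) = (1, 0)" "conj_swap (1, 1) = (1, 1)" "conj_swap (1, 0) = (0, 1)"
  "conj_swap P1 = M1" "conj_swap P2 = M2" "conj_swap M1 = P1" "conj_swap M2 = P2"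
  by (simp_all add: conj_swap_def P1_def P2_def M1_def M2_def \<nu>_def cnj_\<alpha> cnj_\<beta> cnj_c add.commute mult.commute)

lemma vieta_11: "vieta (0, 1) (1, 1) (1, 0)"
  unfolding vieta_def by (intro conjI exI[of _ "-1"]) (simp_all add: f_defs zero_prod_def)

lemma vieta_10: "vieta (1, 1) (1, 0) P1"
  unfolding vieta_def P1_def using c_nz
  by (intro conjI exI[of _ "1"]) (simp_all add: f_defs zero_prod_def)

lemma vieta_P1: "vieta (1, 0) P1 P2"
proof -
  have f: "f2 P1 = 0" "f1 P1 = snd P2" "f0 P1 = - fst P2"
    unfolding f_defs P1_def P2_def \<nu>_def fst_conv snd_conv
    by (simp_all add: algebra_simps power2_eq_square)
  have "P1 \<noteq> 0" using c_nz by (simp add: P1_def zero_prod_def)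
  moreover have "P2 \<noteq> 0" using f form_nonzero[OF \<open>P1 \<noteq> 0\<close>] by auto
  ultimately show ?thesis
    unfolding vieta_def by (intro conjI exI[of _ "- 1"]) (simp_all add: zero_prod_def f)
qed

lemma vieta_01: "vieta (1, 1) (0, 1) M1"
  using vieta_conj_swap[OF vieta_10] by simp

lemma vieta_M1: "vieta (0, 1) M1 M2"
  using vieta_conj_swap[OF vieta_P1] by simp

lemma special_nz [simp]: "P1 \<noteq> 0" "P2 \<noteq> 0" "M1 \<noteq> 0" "M2 \<noteq> 0"
  using vieta_nz[OF vieta_P1] vieta_nz[OF vieta_M1] by auto

text \<open>The condition that the forward half of the explicit chain and its conjugate join up,
  \<open>M2\<close> following \<open>P1\<close> and \<open>P2\<close>. Both \<open>\<nu>\<close> and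
  \<open>\<alpha> * \<beta>\<close> are fixed by conjugation, so the condition is a single real
  equation.\<close>

definition closing :: bool where
  "closing \<longleftrightarrow> (c - \<alpha> * \<beta>) * \<nu> * (\<nu>^2 + c^3) = c^6"

text \<open>The left side is the defect in the criterion of \<open>vieta_of_ratio\<close> for
  \<open>P1\<close>, \<open>P2\<close>, \<open>M2\<close>.\<close>

lemma closing_identity:
  "f0 P2 * snd P1 * snd M2 - f2 P2 * fst P1 * fst M2
     = - c * (c - \<beta>) * (c^6 - (c - \<alpha> * \<beta>) * \<nu> * (\<nu>^2 + c^3))"
  unfolding f_defs P1_def P2_def M2_def \<nu>_def fst_conv snd_conv by algebra

lemma \<beta>_eq_cD: "\<beta> = c \<Longrightarrow> \<alpha> = c"
  using cnj_\<beta> cnj_c by simp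

lemma closing_of_vieta:
  assumes "vieta P1 P2 M2"
  shows closing
proof -
  from assms obtain l where l: "l \<noteq> 0" "f2 P2 = l * (snd P1 * snd M2)" "f0 P2 = l * (fst P1 * fst M2)"
    unfolding vieta_def by blast
  \<comment> \<open>The identity is void when this factor vanishes. In that case \<open>P2\<close>
    would have equal components, so \<open>f0 P2\<close> would vanish, although the first components
    of \<open>P1\<close> and \<open>M2\<close> do not.\<close>
  have "c - \<beta> \<noteq> 0"
  proof
    assume "c - \<beta> = 0"
    then have *: "\<beta> = c" "\<alpha> = c" using \<beta>_eq_cD by auto
    have "fst P2 - snd P2 = - c * (c - \<beta>)" by (simp add: P2_def)
    then have "fst P2 - snd P2 = 0" using \<open>c - \<beta> = 0\<close> by simp
    then have "f0 P2 = 0" by (simp add: f0_def)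
    moreover have "fst P1 * fst M2 = - c * \<alpha> * c * c"
      using * unfolding P1_def M2_def \<nu>_def by simp
    ultimately show False
      using l c_nz *(2) by simp
  qed
  moreover have "f0 P2 * snd P1 * snd M2 - f2 P2 * fst P1 * fst M2 = 0"
    using l by simp
  ultimately show ?thesis
    using closing_identity c_nz unfolding closing_def by auto
qed

lemma vieta_of_closing:
  assumes closing
  shows "vieta P1 P2 M2"
proof -
  have "\<beta> \<noteq> c"
  proof
    assume *: "\<beta> = c"
    then have "\<alpha> = c" by (rule \<beta>_eq_cD)
    with * have "\<nu> = c^2" unfolding \<nu>_def by (simp add: power2_eq_square)
    with assms \<open>\<alpha> = c\<close> * have "(c - c * c) * c^2 * ((c^2)^2 + c^3) = c^6"
      unfolding closing_def by simp
    then have "c^8 = 0" by algebra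
    with c_nz show False by simp
  qed
  moreover have "F P2 P1 = 0"
    using F_commute[of P2 P1] vieta_root_iff[OF vieta_P1, of P2] by simp
  moreover have "f0 P2 * snd P1 * snd M2 = f2 P2 * fst P1 * fst M2"
    using assms closing_identity unfolding closing_def by simp
  ultimately show ?thesis
    using c_nz by (intro vieta_of_ratio special_nz) (simp_all add: P1_def)
qed

text \<open>The chain is matched with the explicit one from both ends, forwards from
  \<open>s 0\<close>, \<open>s 1\<close> and backwards from \<open>s 8\<close>, \<open>s 7\<close>.
  The two halves meet at \<open>s 3\<close>, \<open>s 4\<close>, \<open>s 5\<close>, which must be
  \<open>P1\<close>, \<open>P2\<close>, \<open>M2\<close>.\<close>

lemma closing_of_chain:
  fixes s :: "nat \<Rightarrow> hom_pair"
  assumes v: "\<And>k. k \<le> 6 \<Longrightarrow> vieta (s k) (s (k + 1)) (s (k + 2))"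
    and s0: "bracket (s 0) (0, 1) = 0" and s1: "bracket (s 1) (1, 1) = 0"
    and s7: "bracket (s 7) (0, 1) = 0" and s8: "bracket (s 8) (1, 1) = 0"
  shows closing
proof -
  have v': "vieta (s 0) (s 1) (s 2)" "vieta (s 1) (s 2) (s 3)" "vieta (s 2) (s 3) (s 4)"
    "vieta (s 3) (s 4) (s 5)" "vieta (s 7) (s 6) (s 5)" "vieta (s 8) (s 7) (s 6)"
    using v[of 0] v[of 1] v[of 2] v[of 3] v[of 5] v[of 6]
    by (simp_all add: vieta_commute numeral_eq_Suc)
  have s2: "bracket (s 2) (1, 0) = 0" using vieta_unique[OF v'(1) vieta_11 s0 s1] .
  have s3: "bracket (s 3) P1 = 0" using vieta_unique[OF v'(2) vieta_10 s1 s2] .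
  have s4: "bracket (s 4) P2 = 0" using vieta_unique[OF v'(3) vieta_P1 s2 s3] .
  have s6: "bracket (s 6) M1 = 0" using vieta_unique[OF v'(6) vieta_01 s8 s7] .
  have s5: "bracket (s 5) M2 = 0" using vieta_unique[OF v'(5) vieta_M1 s7 s6] .
  note v'(4)
  then have "vieta P1 P2 M2"
    by (rule vieta_cong) (use s3 s4 s5 in auto)
  then show ?thesis by (rule closing_of_vieta)
qed

text \<open>Integer indices with the line at infinity at 0 turn conjugation into negation of the
  index. The list is a cyclic chain only under \<open>closing\<close>.\<close>

definition cyc :: "int \<Rightarrow> hom_pair" where
  "cyc j = [(1, 1), (1, 0), P1, P2, M2, M1, (0, 1)] ! nat (j mod 7)"

lemma mod_7_cases:
  fixes j :: int
  obtains "j mod 7 = 0" | "j mod 7 = 1" | "j mod 7 = 2" | "j mod 7 = 3" | "j mod 7 = 4"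
    | "j mod 7 = 5" | "j mod 7 = 6"
  using pos_mod_bound[of 7 j] pos_mod_sign[of 7 j] by linarith

lemma cyc_cong: "i mod 7 = j mod 7 \<Longrightarrow> cyc i = cyc j"
  by (simp add: cyc_def)

lemma cyc_neg: "cyc (- j) = conj_swap (cyc j)"
proof -
  have "cyc (- (j mod 7)) = conj_swap (cyc (j mod 7))"
    by (cases j rule: mod_7_cases) (simp_all only:, simp_all add: cyc_def)
  moreover have "cyc (- (j mod 7)) = cyc (- j)" "cyc (j mod 7) = cyc j"
    by (rule cyc_cong, simp add: mod_minus_eq)+
  ultimately show ?thesis by metis
qed

lemma cyc_vieta:
  assumes closing
  shows "vieta (cyc (j - 1)) (cyc j) (cyc (j + 1))"
proof -
  have a: "vieta P1 P2 M2" using vieta_of_closing[OF assms] .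
  have b: "vieta P2 M2 M1" "vieta M2 M1 (0, 1)" "vieta M1 (0, 1) (1, 1)"
    using vieta_conj_swap[OF a] vieta_M1 vieta_01 vieta_commute by simp_all
  have "vieta (cyc (j mod 7 - 1)) (cyc (j mod 7)) (cyc (j mod 7 + 1))"
    by (cases j rule: mod_7_cases)
      (simp_all only:, simp_all add: cyc_def vieta_11 vieta_10 vieta_P1 a b)
  moreover have "cyc (j mod 7 - 1) = cyc (j - 1)" "cyc (j mod 7) = cyc j"
    "cyc (j mod 7 + 1) = cyc (j + 1)"
    by (rule cyc_cong, simp add: mod_diff_left_eq mod_add_left_eq)+
  ultimately show ?thesis by metis
qed

lemma cyc_nz: "cyc j \<noteq> 0"
proof -
  have "(1, 1) \<noteq> (0 :: hom_pair)" "(1, 0) \<noteq> (0 :: hom_pair)" "(0, 1) \<noteq> (0 :: hom_pair)"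
    by (simp_all add: zero_prod_def)
  then show ?thesis
    by (cases j rule: mod_7_cases) (simp_all add: cyc_def)
qed

text \<open>As 7 is prime, some multiple of \<open>d\<close> is 1 modulo 7 (the witnesses are the
  inverses of the residues). The shift would therefore identify the neighbours (1, 1) and (1,
  0).\<close>

lemma cyc_not_shift_invariant:
  assumes "\<not> 7 dvd d" "\<And>k. bracket (cyc k) (cyc (k + d)) = 0"
  shows False
proof -
  have *: "bracket (cyc k) (cyc (k + int q * d)) = 0" for k q
  proof (induction q)
    case (Suc q)
    show ?case
      using bracket_eq_0_trans[OF Suc assms(2) cyc_nz] by (simp add: algebra_simps)
  qed simp
  have "\<exists>q. (int q * d) mod 7 = 1"
  proof -
    have eq: "(int q * d) mod 7 = (int q * (d mod 7)) mod 7" for q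
      by (simp add: mod_mult_right_eq)
    show ?thesis
    proof (cases d rule: mod_7_cases)
      case 1 with assms(1) show ?thesis by auto
    next
      case 2 then show ?thesis by (intro exI[of _ 1]) simp
    next
      case 3 then show ?thesis by (intro exI[of _ 4]) (subst eq, simp)
    next
      case 4 then show ?thesis by (intro exI[of _ 5]) (subst eq, simp)
    next
      case 5 then show ?thesis by (intro exI[of _ 2]) (subst eq, simp)
    next
      case 6 then show ?thesis by (intro exI[of _ 3]) (subst eq, simp)
    next
      case 7 then show ?thesis by (intro exI[of _ 6]) (subst eq, simp)
    qed
  qed
  then obtain q where "(int q * d) mod 7 = 1" ..
  then have "cyc (0 + int q * d) = cyc 1" by (intro cyc_cong) simp
  then have "bracket (cyc 0) (cyc 1) = 0" using * by metis
  then show False by (simp add: cyc_def bracket_def)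
qed

lemma cyc_shift_mod:
  "cyc (j + int (nat (d mod 7))) = cyc (j + d)" "cyc (j - int (nat (d mod 7))) = cyc (j - d)"
  by (intro cyc_cong; simp add: mod_add_right_eq mod_diff_right_eq)+

text \<open>A coincidence makes the whole chain invariant under a translation or a reflection of the index.
  Complex conjugation is itself a reflection, and two reflections compose to a translation.\<close>

lemma cyc_distinct:
  assumes closing "bracket (cyc i) (cyc j) = 0"
  shows "i mod 7 = j mod 7"
proof (rule ccontr)
  assume ne: "i mod 7 \<noteq> j mod 7"
  have "F (cyc i) (cyc (i + 1)) = 0"
    using vieta_root_iff[OF cyc_vieta[OF assms(1), of i]] by simp
  then have "F (cyc j) (cyc (i + 1)) = 0"
    using F_cong[OF assms(2) cyc_nz cyc_nz] by simp
  then consider "bracket (cyc (i + 1)) (cyc (j + 1)) = 0" | "bracket (cyc (i + 1)) (cyc (j - 1)) = 0"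
    using vieta_root_iff[OF cyc_vieta[OF assms(1), of j]] by blast
  then show False
  proof cases
    case 1
    have "bracket (cyc (i + int m)) (cyc (j + int m)) = 0 \<and>
          bracket (cyc (i + int m + 1)) (cyc (j + int m + 1)) = 0" for m
    proof (induction m)
      case 0
      show ?case using assms(2) 1 by simp
    next
      case (Suc m)
      have "bracket (cyc (i + int m + 1 + 1)) (cyc (j + int m + 1 + 1)) = 0"
        by (rule vieta_unique[OF cyc_vieta[OF assms(1), of "i + int m + 1"]
              cyc_vieta[OF assms(1), of "j + int m + 1"]]) (simp_all add: Suc)
      then show ?case using Suc by (simp add: ac_simps)
    qed
    then have *: "bracket (cyc (i + int m)) (cyc (j + int m)) = 0" for m by blast
    show False
    proof (rule cyc_not_shift_invariant[of "j - i"])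
      show "\<not> 7 dvd j - i" using ne by (metis mod_eq_dvd_iff)
      fix k
      show "bracket (cyc k) (cyc (k + (j - i))) = 0"
        using *[of "nat ((k - i) mod 7)"] unfolding cyc_shift_mod by (simp add: algebra_simps)
    qed
  next
    case 2
    have "bracket (cyc (i + int m)) (cyc (j - int m)) = 0 \<and>
          bracket (cyc (i + int m + 1)) (cyc (j - int m - 1)) = 0" for m
    proof (induction m)
      case 0
      show ?case using assms(2) 2 by simp
    next
      case (Suc m)
      have "vieta (cyc (j - int m - 1 + 1)) (cyc (j - int m - 1)) (cyc (j - int m - 1 - 1))"
        using cyc_vieta[OF assms(1), of "j - int m - 1"] vieta_commute by metis
      then have "bracket (cyc (i + int m + 1 + 1)) (cyc (j - int m - 1 - 1)) = 0"
        by (rule vieta_unique[OF cyc_vieta[OF assms(1), of "i + int m + 1"]]) (simp_all add: Suc)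
      then show ?case using Suc by (simp add: ac_simps diff_diff_eq)
    qed
    then have *: "bracket (cyc (i + int m)) (cyc (j - int m)) = 0" for m by blast
    define s where "s = i + j"
    have refl: "bracket (cyc k) (cyc (s - k)) = 0" for k
    proof -
      have "i + (k - i) = k" "j - (k - i) = s - k" by (simp_all add: s_def)
      then show ?thesis
        using *[of "nat ((k - i) mod 7)"] unfolding cyc_shift_mod by metis
    qed
    have refl': "bracket (cyc k) (cyc (- s - k)) = 0" for k
    proof -
      have "bracket (conj_swap (cyc (- k))) (conj_swap (cyc (s + k))) = 0"
        using refl[of "- k"] by (simp add: bracket_conj_swap_eq_0)
      moreover have "- (s + k) = - s - k" by simp
      ultimately show ?thesis
        unfolding cyc_neg[symmetric] minus_minus by metis
    qed
    show False
    \<comment> \<open>If 7 divides \<open>s\<close>, the reflection has the same effect on indices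
      as conjugation, and composing the two gives nothing. But then it identifies
      \<open>cyc 1\<close> with \<open>cyc (- 1)\<close>, which are (1, 0) and (0, 1).\<close>
    proof (cases "7 dvd s")
      case True
      then have "cyc (s - 1) = cyc (- 1)"
        by (intro cyc_cong mod_eq_dvd_iff[THEN iffD2]) simp
      then show False using refl[of 1] by (simp add: cyc_def bracket_def)
    next
      case False
      show False
      proof (rule cyc_not_shift_invariant[of "- 2 * s"])
        show "\<not> 7 dvd - 2 * s" using False by presburger
        show "bracket (cyc k) (cyc (k + - 2 * s)) = 0" for k
        proof -
          have "- s - (s - k) = k + - 2 * s" by simp
          then show ?thesis
            using bracket_eq_0_trans[OF refl[of k] refl'[of "s - k"] cyc_nz] by metis
        qed
      qed
    qed
  qed
qed

end

section \<open>Porism: from an arbitrary Poncelet heptagon to the explicit chain\<close>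

lemma (in tangent_pencil) F_eq:
  "F T S = (fst T * fst S - \<alpha> * ((fst T - snd T) * (fst S - snd S)))
         * (snd T * snd S - \<beta> * ((fst T - snd T) * (fst S - snd S)))
       - (\<alpha> * \<beta> - c) * ((fst T - snd T) * (fst S - snd S))^2"
  unfolding F_def f_defs by algebra

text \<open>The sides of a Poncelet heptagon, unrolled into a periodic sequence that can be run past
  one turn beside another chain.\<close>

locale tangent_polygon = tangent_pencil +
  fixes t :: "nat \<Rightarrow> hom_pair"
  assumes t_nz: "t j \<noteq> 0" and t_periodic: "t (j + 7) = t j"
    and t_edge: "F (t j) (t (j + 1)) = 0"
    and t_distinct: "i mod 7 \<noteq> j mod 7 \<Longrightarrow> bracket (t i) (t j) \<noteq> 0"
begin

lemma t_shift_distinct: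
  assumes "0 < d" "d < 7"
  shows "bracket (t j) (t (j + d)) \<noteq> 0"
proof (rule t_distinct)
  have "(j + d) mod 7 \<noteq> j mod 7"
    using assms nat_dvd_not_less[of d 7] by (simp add: mod_eq_dvd_iff_nat)
  then show "j mod 7 \<noteq> (j + d) mod 7" by simp
qed

lemma t_vieta: "vieta (t j) (t (j + 1)) (t (j + 2))"
proof (rule vieta_of_distinct_roots)
  show "F (t (j + 1)) (t j) = 0" "F (t (j + 1)) (t (j + 2)) = 0"
    using t_edge[of j] t_edge[of "j + 1"] F_commute by (simp_all add: numeral_eq_Suc)
  show "bracket (t j) (t (j + 2)) \<noteq> 0" by (rule t_shift_distinct) simp_all
qed (rule t_nz)+

lemma t_vieta': "vieta (t (j + 6)) (t j) (t (j + 1))"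
  using t_vieta[of "j + 6"] t_periodic[of j] t_periodic[of "j + 1"] by (simp add: numeral_eq_Suc)

lemma t_neighbour:
  assumes "bracket (t j) S = 0" "S \<noteq> 0" "F S S' = 0"
  obtains i where "bracket (t i) S' = 0"
proof -
  have "F (t j) S' = 0" using F_cong[OF assms(1) t_nz assms(2)] assms(3) by simp
  then show ?thesis
    using vieta_root_iff[OF t_vieta'[of j]] bracket_eq_0_commute that by metis
qed

text \<open>Such a polygon contains the explicit chain, traversed in one of two directions. It is
  treated separately because the quotients used for the other polygons would have zero
  denominators.\<close>

lemma closing_of_infinite_side:
  assumes "bracket (t j) (1, 1) = 0"
  shows closing
proof -
  have nz: "(1, 1) \<noteq> (0 :: hom_pair)" "(1, 0) \<noteq> (0 :: hom_pair)" "(0, 1) \<noteq> (0 :: hom_pair)"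
    by (simp_all add: zero_prod_def)
  have r: "F (1, 1) W = 0 \<longleftrightarrow> bracket W (0, 1) = 0 \<or> bracket W (1, 0) = 0" for W
    by (rule vieta_root_iff[OF vieta_11])
  have "F (t j) (t (j + 6)) = 0" "F (t j) (t (j + 1)) = 0"
    using vieta_root_iff[OF t_vieta'[of j]] by auto
  then have e: "bracket (t (j + 6)) (0, 1) = 0 \<or> bracket (t (j + 6)) (1, 0) = 0"
     "bracket (t (j + 1)) (0, 1) = 0 \<or> bracket (t (j + 1)) (1, 0) = 0"
    using F_cong[OF assms t_nz nz(1)] r by simp_all
  have "bracket (t (j + 6)) (t (j + 1)) \<noteq> 0"
    using t_shift_distinct[of 5 "j + 1"] by (simp add: bracket_eq_0_commute ac_simps)
  then have "\<not> (bracket (t (j + 6)) (1, 0) = 0 \<and> bracket (t (j + 1)) (1, 0) = 0)"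
    using bracket_eq_0_trans[OF _ _ nz(2)] bracket_eq_0_commute by metis
  then consider "bracket (t (j + 6)) (0, 1) = 0" | "bracket (t (j + 1)) (0, 1) = 0"
    using e by blast
  then show ?thesis
  proof cases
    case 1
    show ?thesis
    proof (rule closing_of_chain[of "\<lambda>k. t (j + 6 + k)"])
      show "vieta (t (j + 6 + k)) (t (j + 6 + (k + 1))) (t (j + 6 + (k + 2)))" for k
        using t_vieta[of "j + 6 + k"] by (simp add: ac_simps)
      show "bracket (t (j + 6 + 0)) (0, 1) = 0" "bracket (t (j + 6 + 7)) (0, 1) = 0"
        using 1 t_periodic[of "j + 6"] by simp_all
      show "bracket (t (j + 6 + 1)) (1, 1) = 0" "bracket (t (j + 6 + 8)) (1, 1) = 0"
        using assms t_periodic[of j] t_periodic[of "j + 7"] by (simp_all add: ac_simps)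
    qed
  next
    case 2
    show ?thesis
    \<comment> \<open>Since 15 is 1 modulo 7, the reversed walk starts with
      \<open>t (j + 1)\<close>, \<open>t j\<close>; for \<open>k\<close> up to 8 the subtraction is
      never truncated.\<close>
    proof (rule closing_of_chain[of "\<lambda>k. t (j + (15 - k))"])
      show "vieta (t (j + (15 - k))) (t (j + (15 - (k + 1)))) (t (j + (15 - (k + 2))))" if "k \<le> 6" for k
      proof -
        have "j + (15 - (k + 2)) + 1 = j + (15 - (k + 1))" "j + (15 - (k + 2)) + 2 = j + (15 - k)"
          using that by simp_all
        then show ?thesis
          using t_vieta[of "j + (15 - (k + 2))"] vieta_commute by metis
      qed
      show "bracket (t (j + (15 - 0))) (0, 1) = 0" "bracket (t (j + (15 - 7))) (0, 1) = 0"
        using 2 t_periodic[of "j + 1"] t_periodic[of "j + 8"] by (simp_all add: ac_simps)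
      show "bracket (t (j + (15 - 1))) (1, 1) = 0" "bracket (t (j + (15 - 8))) (1, 1) = 0"
        using assms t_periodic[of j] t_periodic[of "j + 7"] by (simp_all add: ac_simps)
    qed
  qed
qed

end

text \<open>An infinite chain with the same beginning as the explicit one, needed because its return
  after seven steps is still to be proved.\<close>

lemma (in tangent_pencil) chain_exists:
  obtains s :: "nat \<Rightarrow> hom_pair" where "s 0 = (0, 1)" "s 1 = (1, 1)" "\<And>k. vieta (s k) (s (k + 1)) (s (k + 2))"
proof -
  define f where "f = rec_nat ((0, 1), (1, 1)) (\<lambda>_ (S, T). (T, SOME R. vieta S T R))"
  define s where "s k = fst (f k)" for k
  have f: "f 0 = ((0, 1), (1, 1))" "f (Suc k) = (snd (f k), SOME R. vieta (fst (f k)) (snd (f k)) R)" for k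
    by (simp_all only: f_def old.nat.rec split_beta)
  have inv: "fst (f k) \<noteq> 0 \<and> snd (f k) \<noteq> 0 \<and> F (snd (f k)) (fst (f k)) = 0" for k
  proof (induction k)
    case 0
    show ?case
      using vieta_root_iff[OF vieta_11] by (simp add: f zero_prod_def)
  next
    case (Suc k)
    then obtain R where "vieta (fst (f k)) (snd (f k)) R" using vieta_exists by blast
    then have v: "vieta (fst (f k)) (snd (f k)) (snd (f (Suc k)))"
      unfolding f(2) snd_conv by (rule someI)
    have "fst (f (Suc k)) = snd (f k)" by (simp add: f)
    then show ?case
      using vieta_nz[OF v] vieta_root_iff[OF v, of "snd (f (Suc k))"]
        F_commute[of "snd (f k)" "snd (f (Suc k))"] by (simp only: bracket_self simp_thms)
  qed
  have "vieta (s k) (s (k + 1)) (s (k + 2))" for k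
  proof -
    obtain R where "vieta (fst (f k)) (snd (f k)) R" using vieta_exists inv by blast
    then have "vieta (fst (f k)) (snd (f k)) (snd (f (Suc k)))"
      unfolding f(2) snd_conv by (rule someI)
    then show ?thesis by (simp add: s_def f)
  qed
  then show ?thesis
    by (intro that[of s]) (simp_all add: s_def f)
qed

text \<open>The polarization of \<open>(bracket T T')^2\<close>, the discriminant of the pair. Since
  the parabola consists of the points where both tangents coincide, this is its equation polarized
  at two meeting points.\<close>

definition dual_polar :: "hom_pair \<Rightarrow> hom_pair \<Rightarrow> hom_pair \<Rightarrow> hom_pair \<Rightarrow> complex" where
  "dual_polar T T' S S' = bracket T S' * bracket S T' + bracket T S * bracket S' T'"

lemma bracket_mult_flip: "bracket A B * bracket C D = bracket D C * bracket B A"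
  by (simp add: bracket_def algebra_simps)

locale skew_chain = tangent_polygon +
  fixes s :: "nat \<Rightarrow> hom_pair"
  assumes s_0: "s 0 = (0, 1)" and s_1: "s 1 = (1, 1)"
    and s_vieta: "vieta (s k) (s (k + 1)) (s (k + 2))"
    and t_finite: "bracket (t j) (1, 1) \<noteq> 0"
begin

lemma s_nz: "s k \<noteq> 0"
  using vieta_nz[OF s_vieta] by blast

lemma s_edge: "F (s k) (s (k + 1)) = 0"
  using vieta_root_iff[OF s_vieta[of k], of "s k"] F_commute[of "s k"] by simp

text \<open>A coincidence passes to neighbours, hence down the chain to \<open>s 0\<close> and from
  there to \<open>s 1\<close>, the line at infinity, which is not a side. This keeps all later
  denominators nonzero.\<close>

lemma skew: "bracket (t i) (s k) \<noteq> 0"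
proof (induction k arbitrary: i)
  case 0
  show ?case
  proof
    assume "bracket (t i) (s 0) = 0"
    then obtain i' where "bracket (t i') (s (0 + 1)) = 0"
      by (rule t_neighbour[OF _ s_nz s_edge])
    then show False using t_finite s_1 by simp
  qed
next
  case (Suc k)
  show ?case
  proof
    assume "bracket (t i) (s (Suc k)) = 0"
    moreover have "F (s (Suc k)) (s k) = 0"
      using s_edge[of k] F_commute[of "s k"] by simp
    ultimately obtain i' where "bracket (t i') (s k) = 0"
      by (rule t_neighbour[OF _ s_nz])
    then show False using Suc by simp
  qed
qed

lemma skew': "bracket (s k) (t i) \<noteq> 0"
  using skew bracket_eq_0_commute by blast

text \<open>By \<open>chain_invariance\<close> the quotient \<open>Y\<close> is unchanged when both
  chains advance. Seven steps restore the polygon but move the pair \<open>s 0\<close>,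
  \<open>s 1\<close> to \<open>s 7\<close>, \<open>s 8\<close>.\<close>

lemma G_parallel_shift:
  "G (t i) (t (i + 1)) (s 7) (s 8) * (bracket (t i) (s 1) * bracket (s 0) (t (i + 1)))
   = G (t i) (t (i + 1)) (s 0) (s 1) * (bracket (t i) (s 8) * bracket (s 7) (t (i + 1)))"
proof -
  define Y where "Y i j = G (t i) (t (i + 1)) (s j) (s (j + 1)) / (bracket (t i) (s (j + 1)) * bracket (s j) (t (i + 1)))"
    for i j
  have step: "Y i j = Y (i + 1) (j + 1)" for i j
  proof -
    have "bracket (t (i + 2)) (s (j + 1)) * bracket (s (j + 2)) (t (i + 1))
        = bracket (t (i + 1)) (s (j + 2)) * bracket (s (j + 1)) (t (i + 2))"
      by (rule bracket_mult_flip)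
    then have "G (t i) (t (i + 1)) (s j) (s (j + 1)) * (bracket (t (i + 1)) (s (j + 2)) * bracket (s (j + 1)) (t (i + 2)))
        = G (t (i + 1)) (t (i + 2)) (s (j + 1)) (s (j + 2)) * (bracket (t i) (s (j + 1)) * bracket (s j) (t (i + 1)))"
      using chain_invariance[OF t_vieta[of i] s_vieta[of j]] by (metis mult.commute)
    then show ?thesis
      unfolding Y_def add.assoc one_add_one by (subst frac_eq_eq) (simp_all only: mult_eq_0_iff skew skew' simp_thms)
  qed
  have "Y i j = Y (i + m) (j + m)" for m j
  proof (induction m)
    case (Suc m)
    then show ?case using step[of "i + m" "j + m"] by simp
  qed simp
  from this[of 0 7] have "Y i 0 = Y (i + 7) 7" by simp
  also have "t (i + 7 + 1) = t (i + 1)" using t_periodic[of "i + 1"] by (simp add: ac_simps)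
  then have "Y (i + 7) 7 = Y i 7" unfolding Y_def t_periodic by simp
  finally show ?thesis
    unfolding Y_def by (subst (asm) frac_eq_eq) (simp_all add: skew skew')
qed

text \<open>The companion invariant: \<open>chain_invariance\<close> applied with \<open>s\<close>
  read backwards, so that one chain advances while the other retreats.\<close>

lemma G_opposite_shift:
  "G (t i) (t (i + 1)) (s 7) (s 8) * (bracket (t i) (s 0) * bracket (s 1) (t (i + 1)))
   = G (t i) (t (i + 1)) (s 0) (s 1) * (bracket (t i) (s 7) * bracket (s 8) (t (i + 1)))"
proof -
  define Y where "Y i j = G (t i) (t (i + 1)) (s j) (s (j + 1)) / (bracket (t i) (s j) * bracket (s (j + 1)) (t (i + 1)))"
    for i j
  have step: "Y i (j + 1) = Y (i + 1) j" for i j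
  proof -
    have "bracket (t (i + 2)) (s (j + 1)) * bracket (s j) (t (i + 1))
        = bracket (t (i + 1)) (s j) * bracket (s (j + 1)) (t (i + 2))"
      by (rule bracket_mult_flip)
    moreover have "vieta (s (j + 2)) (s (j + 1)) (s j)" using s_vieta vieta_commute by blast
    from chain_invariance[OF t_vieta[of i] this]
    have "bracket (t i) (s (j + 1)) * bracket (s (j + 2)) (t (i + 1)) * G (t (i + 1)) (t (i + 2)) (s j) (s (j + 1))
        = bracket (t (i + 2)) (s (j + 1)) * bracket (s j) (t (i + 1)) * G (t i) (t (i + 1)) (s (j + 1)) (s (j + 2))"
      unfolding G_commute(2)[of _ _ "s (j + 1)" "s j"] G_commute(2)[of _ _ "s (j + 2)" "s (j + 1)"] .
    ultimately have "G (t i) (t (i + 1)) (s (j + 1)) (s (j + 2)) * (bracket (t (i + 1)) (s j) * bracket (s (j + 1)) (t (i + 2)))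
        = G (t (i + 1)) (t (i + 2)) (s j) (s (j + 1)) * (bracket (t i) (s (j + 1)) * bracket (s (j + 2)) (t (i + 1)))"
      by (metis mult.commute)
    then show ?thesis
      unfolding Y_def add.assoc one_add_one by (subst frac_eq_eq) (simp_all only: mult_eq_0_iff skew skew' simp_thms)
  qed
  have "Y i (j + m) = Y (i + m) j" for m j i
  proof (induction m arbitrary: i)
    case (Suc m)
    then show ?case using step[of i "j + m"] by simp
  qed simp
  from this[of i 0 7] have "Y i 7 = Y (i + 7) 0" by simp
  also have "t (i + 7 + 1) = t (i + 1)" using t_periodic[of "i + 1"] by (simp add: ac_simps)
  then have "Y (i + 7) 0 = Y i 0" unfolding Y_def t_periodic by simp
  finally show ?thesis
    unfolding Y_def by (subst (asm) frac_eq_eq) (simp_all add: skew skew')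
qed

text \<open>Neither denominator alone is a function of the vertex. Their sum is symmetric in the two
  sides and in the two members of \<open>s\<close>, hence is one.\<close>

lemma dual_polar_proportional:
  "G (t i) (t (i + 1)) (s 7) (s 8) * dual_polar (t i) (t (i + 1)) (s 0) (s 1)
   = G (t i) (t (i + 1)) (s 0) (s 1) * dual_polar (t i) (t (i + 1)) (s 7) (s 8)"
  using G_parallel_shift[of i] G_opposite_shift[of i]
  unfolding dual_polar_def by (simp add: distrib_left)

definition \<zeta> :: "nat \<Rightarrow> complex" where
  "\<zeta> i = (fst (t i) - snd (t i)) * (fst (t (i + 1)) - snd (t (i + 1)))"

text \<open>With X, Y, Z the coordinates of the vertex on \<open>t i\<close> and
  \<open>t (i + 1)\<close>, this is X / Z - \<alpha>. On the circle Y / Z - \<beta> is then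
  (\<alpha> \<beta> - c) / w, so \<open>w\<close> is a rational parameter of the circle.\<close>

definition w :: "nat \<Rightarrow> complex" where
  "w i = fst (t i) * fst (t (i + 1)) / \<zeta> i - \<alpha>"

lemma \<zeta>_nz: "\<zeta> i \<noteq> 0"
  using t_finite[of i] t_finite[of "i + 1"] by (simp add: \<zeta>_def bracket_def)

lemma fst_fst: "fst (t i) * fst (t (i + 1)) = (w i + \<alpha>) * \<zeta> i"
  by (simp add: w_def \<zeta>_nz)

lemma circle_equation:
  "(fst (t i) * fst (t (i + 1)) - \<alpha> * \<zeta> i) * (snd (t i) * snd (t (i + 1)) - \<beta> * \<zeta> i)
   = (\<alpha> * \<beta> - c) * (\<zeta> i)^2"
  using t_edge[of i] unfolding F_eq \<zeta>_def by simp

lemma G_base: "G (t i) (t (i + 1)) (s 0) (s 1) = w i * \<zeta> i"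
  unfolding G_def Let_def s_0 s_1 fst_conv snd_conv \<zeta>_def[symmetric] fst_fst
  by (simp add: algebra_simps)

lemma w_nz: "w i \<noteq> 0"
proof
  assume "w i = 0"
  then have "(\<alpha> * \<beta> - c) * (\<zeta> i)^2 = 0"
    using circle_equation[of i] unfolding fst_fst by simp
  then show False using \<delta>_nz \<zeta>_nz by simp
qed

lemma snd_snd: "w i * (snd (t i) * snd (t (i + 1))) = (\<beta> * w i + (\<alpha> * \<beta> - c)) * \<zeta> i"
proof -
  have "\<zeta> i * (w i * (snd (t i) * snd (t (i + 1)))) = \<zeta> i * ((\<beta> * w i + (\<alpha> * \<beta> - c)) * \<zeta> i)"
    using circle_equation[of i] unfolding fst_fst by (simp add: algebra_simps power2_eq_square)
  then show ?thesis using \<zeta>_nz by simp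
qed

text \<open>The parameter fixes the vertex, and the vertex fixes the quadratic whose roots are the
  two sides through it (\<open>bracket2\<close>). Distinct indices modulo 7 give distinct pairs of
  consecutive sides.\<close>

lemma w_inj: "inj_on w {..<7}"
proof (rule inj_onI)
  fix i k assume ik: "i \<in> {..<7}" "k \<in> {..<7}" and eq: "w i = w k"
  have x: "fst (t i) * fst (t (i + 1)) * \<zeta> k = fst (t k) * fst (t (k + 1)) * \<zeta> i"
    unfolding fst_fst eq by simp
  have "w i * (snd (t i) * snd (t (i + 1)) * \<zeta> k) = (w i * (snd (t i) * snd (t (i + 1)))) * \<zeta> k"
    by simp
  also have "\<dots> = (w k * (snd (t k) * snd (t (k + 1)))) * \<zeta> i"
    unfolding snd_snd by (simp add: eq)
  also have "\<dots> = w i * (snd (t k) * snd (t (k + 1)) * \<zeta> i)"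
    by (simp add: eq)
  finally have y: "snd (t i) * snd (t (i + 1)) * \<zeta> k = snd (t k) * snd (t (k + 1)) * \<zeta> i"
    using w_nz by simp
  have bracket2: "bracket T (t i) * bracket T (t (i + 1)) =
      (fst T)^2 * (snd (t i) * snd (t (i + 1)))
      - fst T * snd T * (fst (t i) * fst (t (i + 1)) + snd (t i) * snd (t (i + 1)) - \<zeta> i)
      + (snd T)^2 * (fst (t i) * fst (t (i + 1)))" for T i
    unfolding bracket_def \<zeta>_def by algebra
  have *: "bracket T (t i) * bracket T (t (i + 1)) * \<zeta> k = bracket T (t k) * bracket T (t (k + 1)) * \<zeta> i" for T
  proof -
    have "bracket T (t i) * bracket T (t (i + 1)) * \<zeta> k =
      (fst T)^2 * (snd (t i) * snd (t (i + 1)) * \<zeta> k)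
      - fst T * snd T * (fst (t i) * fst (t (i + 1)) * \<zeta> k + snd (t i) * snd (t (i + 1)) * \<zeta> k - \<zeta> i * \<zeta> k)
      + (snd T)^2 * (fst (t i) * fst (t (i + 1)) * \<zeta> k)"
      unfolding bracket2 by algebra
    also have "\<dots> = bracket T (t k) * bracket T (t (k + 1)) * \<zeta> i"
      unfolding bracket2 x y by algebra
    finally show ?thesis .
  qed
  have "bracket (t i) (t k) = 0 \<or> bracket (t i) (t (k + 1)) = 0"
    using *[of "t i"] \<zeta>_nz by simp
  moreover have "bracket (t (i + 1)) (t k) = 0 \<or> bracket (t (i + 1)) (t (k + 1)) = 0"
    using *[of "t (i + 1)"] \<zeta>_nz by simp
  ultimately have "(i mod 7 = k mod 7 \<or> i mod 7 = (k + 1) mod 7) \<and>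
      ((i + 1) mod 7 = k mod 7 \<or> (i + 1) mod 7 = (k + 1) mod 7)"
    using t_distinct by blast
  moreover have "i mod 7 = i" "k mod 7 = k" "(i + 1) mod 7 = (if i = 6 then 0 else i + 1)"
    "(k + 1) mod 7 = (if k = 6 then 0 else k + 1)"
    using ik by auto
  ultimately show "i = k" by (auto split: if_splits)
qed

text \<open>In the coordinate \<open>w\<close> of the circle, whose value at the circular point \<open>(s 0, s 1)\<close> is \<open>0\<close>,
  the relation \<open>dual_polar_proportional\<close> is a quartic equation with the seven roots \<open>w i\<close>.\<close>

lemma chain_returns:
  "fst (s 7) * fst (s 8) = 0" "(fst (s 7) - snd (s 7)) * (fst (s 8) - snd (s 8)) = 0"
proof -
  define a b z \<delta> where "a = fst (s 7) * fst (s 8)" and "b = snd (s 7) * snd (s 8)"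
    and "z = (fst (s 7) - snd (s 7)) * (fst (s 8) - snd (s 8))" and "\<delta> = \<alpha> * \<beta> - c"
  \<comment> \<open>Up to the factor \<open>\<zeta> i\<close>, these are \<open>w i\<close> times
    \<open>G\<close> at the returned pair and \<open>dual_polar\<close> at the initial and at the
    returned pair. The extra \<open>w i\<close> clears the denominator of Y.\<close>
  define p1 p2 p3 where
    "p1 = [:\<delta> * a - z * \<alpha> * \<delta>, \<beta> * a + \<alpha> * b - (\<alpha> * b + \<beta> * a) - 2 * z * \<alpha> * \<beta> + 2 * c * z, b - z * \<beta>:]" and
    "p2 = [:\<delta>, \<beta> - \<alpha> - 1, - 1:]" and
    "p3 = [:\<delta> * (a + b - z) - 2 * \<delta> * a, (\<alpha> + \<beta> - 1) * (a + b - z) - 2 * \<alpha> * b - 2 * \<beta> * a,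
            a + b - z - 2 * b:]"
  define p where "p = p1 * p2 - [:0, 0, 1:] * p3"
  have root: "poly p (w i) = 0" for i
  proof -
    note G0 = G_base[of i]
    have D0: "w i * dual_polar (t i) (t (i + 1)) (s 0) (s 1) = poly p2 (w i) * \<zeta> i"
    proof -
      have eq: "dual_polar (t i) (t (i + 1)) (s 0) (s 1)
          = snd (t i) * snd (t (i + 1)) - fst (t i) * fst (t (i + 1)) - \<zeta> i"
        unfolding dual_polar_def bracket_def s_0 s_1 \<zeta>_def fst_conv snd_conv by algebra
      have "w i * dual_polar (t i) (t (i + 1)) (s 0) (s 1)
          = w i * (snd (t i) * snd (t (i + 1))) - w i * ((w i + \<alpha>) * \<zeta> i) - w i * \<zeta> i"
        unfolding eq fst_fst by algebra
      from this[unfolded snd_snd] show ?thesis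
        unfolding p2_def \<delta>_def by (simp add: algebra_simps)
    qed
    have G7: "w i * G (t i) (t (i + 1)) (s 7) (s 8) = poly p1 (w i) * \<zeta> i"
    proof -
      have eq: "G (t i) (t (i + 1)) (s 7) (s 8)
          = fst (t i) * fst (t (i + 1)) * b + snd (t i) * snd (t (i + 1)) * a - \<zeta> i * (\<alpha> * b + \<beta> * a)
            - z * (\<alpha> * (snd (t i) * snd (t (i + 1))) + \<beta> * (fst (t i) * fst (t (i + 1)))) + 2 * c * \<zeta> i * z"
        unfolding G_def Let_def a_def b_def z_def \<zeta>_def by simp
      have "w i * G (t i) (t (i + 1)) (s 7) (s 8)
          = w i * ((w i + \<alpha>) * \<zeta> i) * b + (w i * (snd (t i) * snd (t (i + 1)))) * a - w i * \<zeta> i * (\<alpha> * b + \<beta> * a)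
            - z * (\<alpha> * (w i * (snd (t i) * snd (t (i + 1)))) + \<beta> * (w i * ((w i + \<alpha>) * \<zeta> i))) + 2 * c * w i * \<zeta> i * z"
        unfolding eq fst_fst by algebra
      from this[unfolded snd_snd] show ?thesis
        unfolding p1_def \<delta>_def by (simp add: algebra_simps)
    qed
    have D7: "w i * dual_polar (t i) (t (i + 1)) (s 7) (s 8) = poly p3 (w i) * \<zeta> i"
    proof -
      have eq: "dual_polar (t i) (t (i + 1)) (s 7) (s 8)
          = (fst (t i) * fst (t (i + 1)) + snd (t i) * snd (t (i + 1)) - \<zeta> i) * (a + b - z)
            - 2 * (fst (t i) * fst (t (i + 1))) * b - 2 * (snd (t i) * snd (t (i + 1))) * a"
        unfolding dual_polar_def bracket_def a_def b_def z_def \<zeta>_def by algebra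
      have "w i * dual_polar (t i) (t (i + 1)) (s 7) (s 8)
          = (w i * ((w i + \<alpha>) * \<zeta> i) + w i * (snd (t i) * snd (t (i + 1))) - w i * \<zeta> i) * (a + b - z)
            - 2 * (w i * ((w i + \<alpha>) * \<zeta> i)) * b - 2 * (w i * (snd (t i) * snd (t (i + 1)))) * a"
        unfolding eq fst_fst by algebra
      from this[unfolded snd_snd] show ?thesis
        unfolding p3_def \<delta>_def by (simp add: algebra_simps)
    qed
    have "\<zeta> i * \<zeta> i * (poly p1 (w i) * poly p2 (w i))
        = (w i * G (t i) (t (i + 1)) (s 7) (s 8)) * (w i * dual_polar (t i) (t (i + 1)) (s 0) (s 1))"
      unfolding G7 D0 by simp
    also have "\<dots> = w i * G (t i) (t (i + 1)) (s 0) (s 1) * (w i * dual_polar (t i) (t (i + 1)) (s 7) (s 8))"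
      using dual_polar_proportional[of i] by (simp add: algebra_simps)
    also have "\<dots> = \<zeta> i * \<zeta> i * (w i * w i * poly p3 (w i))"
      unfolding G0 D7 by simp
    finally show ?thesis using \<zeta>_nz[of i] by (simp add: p_def algebra_simps)
  qed
  have "p = 0"
  proof (rule ccontr)
    assume "p \<noteq> 0"
    have "degree p1 \<le> 2" "degree p2 \<le> 2" "degree p3 \<le> 2" "degree [:0, 0, 1 :: complex:] \<le> 2"
      by (simp_all add: p1_def p2_def p3_def)
    then have "degree (p1 * p2) \<le> 4" "degree ([:0, 0, 1:] * p3) \<le> 4"
      using degree_mult_le[of p1 p2] degree_mult_le[of "[:0, 0, 1:]" p3] by linarith+
    then have "degree p \<le> 4" unfolding p_def by (rule degree_diff_le)
    moreover have "card (w ` {..<7}) \<le> card {x. poly p x = 0}"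
      using root \<open>p \<noteq> 0\<close> by (intro card_mono poly_roots_finite) auto
    moreover have "card {x. poly p x = 0} \<le> degree p"
      using \<open>p \<noteq> 0\<close> by (rule card_poly_roots_bound)
    moreover have "card (w ` {..<7}) = 7"
      using card_image[OF w_inj] by simp
    ultimately show False by linarith
  qed
  \<comment> \<open>At 0 the term with \<open>p3\<close> drops out. What remains says that the
    meeting point of \<open>s 7\<close> and \<open>s 8\<close> lies on the tangent of the circle at
    the circular point; that tangent meets the circle only there.\<close>
  then have "poly p 0 = 0" by simp
  then have "(a - \<alpha> * z) * (\<delta> * \<delta>) = 0"
    by (simp add: p_def p1_def p2_def algebra_simps)
  then have a: "a = \<alpha> * z" using \<delta>_nz by (simp add: \<delta>_def)
  have "F (s 7) (s 8) = 0" using s_edge[of 7] by simp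
  then have "(a - \<alpha> * z) * (b - \<beta> * z) = \<delta> * z^2"
    unfolding a_def b_def z_def \<delta>_def F_eq by simp
  then have "z = 0" using a \<delta>_nz by (simp add: \<delta>_def)
  with a show "fst (s 7) * fst (s 8) = 0" "(fst (s 7) - snd (s 7)) * (fst (s 8) - snd (s 8)) = 0"
    by (simp_all add: a_def z_def)
qed

text \<open>The meeting point determines \<open>s 7\<close> and \<open>s 8\<close> only as an
  unordered pair. In the exchanged order the parallel shift would equate two products whose
  difference is \<open>- bracket (t 0) (t 1)\<close>, making adjacent sides equal.\<close>

lemma closing_of_skew_chain: closing
proof -
  have nz: "fst (s k) \<noteq> 0 \<or> snd (s k) \<noteq> 0" for k
    using s_nz[of k] by (metis prod.collapse zero_prod_def)
  have "fst (s 7) = 0 \<or> fst (s 8) = 0" "fst (s 7) = snd (s 7) \<or> fst (s 8) = snd (s 8)"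
    using chain_returns by simp_all
  then consider "fst (s 7) = snd (s 7)" "fst (s 8) = 0" | "fst (s 7) = 0" "fst (s 8) = snd (s 8)"
    using nz[of 7] nz[of 8] by metis
  then show ?thesis
  proof cases
    case 1
    define g h where "g = fst (s 7)" and "h = snd (s 8)"
    have gh: "s 7 = (g, g)" "s 8 = (0, h)"
      using 1 g_def h_def by (metis prod.collapse)+
    have gh_nz: "g \<noteq> 0" "h \<noteq> 0" using 1 nz[of 7] nz[of 8] by (auto simp: g_def h_def)
    have G0: "G (t 0) (t 1) (s 0) (s 1) \<noteq> 0" using G_base[of 0] w_nz \<zeta>_nz by simp
    have G7: "G (t 0) (t 1) (s 7) (s 8) = g * h * G (t 0) (t 1) (s 0) (s 1)"
      unfolding G_def Let_def s_0 s_1 gh fst_conv snd_conv by algebra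
    have b: "bracket (t 0) (s 8) * bracket (s 7) (t 1) = g * h * (bracket (t 0) (s 0) * bracket (s 1) (t 1))"
      unfolding bracket_def s_0 s_1 gh fst_conv snd_conv by algebra
    have "g * h * G (t 0) (t 1) (s 0) (s 1) * (bracket (t 0) (s 1) * bracket (s 0) (t 1))
        = G (t 0) (t 1) (s 0) (s 1) * (g * h * (bracket (t 0) (s 0) * bracket (s 1) (t 1)))"
      using G_parallel_shift[of 0] unfolding add_0 G7 b .
    then have "bracket (t 0) (s 1) * bracket (s 0) (t 1) = bracket (t 0) (s 0) * bracket (s 1) (t 1)"
      using G0 gh_nz by simp
    moreover have "bracket (t 0) (s 1) * bracket (s 0) (t 1) - bracket (t 0) (s 0) * bracket (s 1) (t 1) = - bracket (t 0) (t 1)"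
      unfolding bracket_def s_0 s_1 fst_conv snd_conv by algebra
    ultimately have "bracket (t 0) (t 1) = 0" by simp
    then show ?thesis using t_distinct[of 0 1] by simp
  next
    case 2
    show ?thesis
    proof (rule closing_of_chain[of s])
      show "vieta (s k) (s (k + 1)) (s (k + 2))" for k by (rule s_vieta)
      show "bracket (s 0) (0, 1) = 0" "bracket (s 1) (1, 1) = 0" "bracket (s 7) (0, 1) = 0" "bracket (s 8) (1, 1) = 0"
        unfolding s_0 s_1 bracket_def fst_conv snd_conv using 2 by simp_all
    qed
  qed
qed

end

context tangent_polygon
begin

theorem closing_of_polygon: closing
proof (cases "\<exists>j. bracket (t j) (1, 1) = 0")
  case True
  then obtain j where "bracket (t j) (1, 1) = 0" ..
  then show ?thesis by (rule closing_of_infinite_side)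
next
  case False
  obtain s :: "nat \<Rightarrow> hom_pair" where s: "s 0 = (0, 1)" "s 1 = (1, 1)" "\<And>k. vieta (s k) (s (k + 1)) (s (k + 2))"
    using chain_exists by metis
  have "skew_chain \<alpha> \<beta> c t s"
    by (rule skew_chain.intro[OF tangent_polygon_axioms], rule skew_chain_axioms.intro)
      (use s False in blast)+
  then show ?thesis by (rule skew_chain.closing_of_skew_chain)
qed

end

section \<open>Tangent lines of the parabola\<close>

lemma proportional_refl: "u \<noteq> 0 \<Longrightarrow> proportional u u"
  unfolding proportional_def by (auto intro!: exI[of _ 1])

lemma cp2_cases:
  obtains u where "u \<noteq> 0" "P = abs_cp2 u"
proof (induction P rule: cp2.abs_induct)
  case (1 u)
  then show ?case unfolding proportional_def by blast
qed

lemma abs_cp2_mem_proj_line: "u \<noteq> 0 \<Longrightarrow> abs_cp2 u \<in> proj_line a \<longleftrightarrow> pairing a u = 0"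
  by (simp add: proj_line_def incident.abs_eq proportional_refl)

lemma abs_cp2_mem_conic: "u \<noteq> 0 \<Longrightarrow> abs_cp2 u \<in> conic_points A \<longleftrightarrow> pairing u (A *v u) = 0"
  by (simp add: conic_points_def on_conic.abs_eq proportional_refl)

lemma tangent_line_at_abs: "u \<noteq> 0 \<Longrightarrow> tangent_line_at A (abs_cp2 u) = proj_line (A *v u)"
  by (simp add: tangent_line_at.abs_eq proportional_refl)

lemma vec3_eq_iff: "(u :: complex^3) = v \<longleftrightarrow> u $ 1 = v $ 1 \<and> u $ 2 = v $ 2 \<and> u $ 3 = v $ 3"
  by (simp add: vec_eq_iff forall_3)

lemma pairing_unit_circle:
  "pairing u (unit_circle (a, b) *v u) =
     (u $ 1)^2 + (u $ 2)^2 - 2 * (of_real a * u $ 1 + of_real b * u $ 2) * u $ 3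
     + (of_real a ^2 + of_real b ^2 - 1) * (u $ 3)^2"
  by (simp add: pairing_def matrix_vector_mult_def sum_3 unit_circle_def complexify_def
      algebra_simps power2_eq_square)

lemma pairing_parabola:
  "pairing (parabola p *v u) w =
     u $ 2 * w $ 2 - of_real p * (u $ 1 * w $ 3 + u $ 3 * w $ 1) - (of_real p)^2 * (u $ 3 * w $ 3)"
  by (simp add: pairing_def matrix_vector_mult_def sum_3 parabola_def complexify_def
      algebra_simps power2_eq_square)

lemma pairing_parabola_self:
  "pairing u (parabola p *v u) = pairing (parabola p *v u) u"
  by (simp add: pairing_def mult.commute)

lemma proj_line_smult:
  assumes "k \<noteq> 0"
  shows "proj_line (k *s a) = proj_line a"
proof (rule set_eqI)
  fix P show "P \<in> proj_line (k *s a) \<longleftrightarrow> P \<in> proj_line a"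
    using assms by (cases P rule: cp2_cases) (simp add: abs_cp2_mem_proj_line)
qed

lemma proportional_triple:
  fixes X Y Z a b c :: complex
  assumes "a \<noteq> 0 \<or> b \<noteq> 0 \<or> c \<noteq> 0" "X * b = Y * a" "X * c = Z * a" "Y * c = Z * b"
  obtains k where "X = k * a" "Y = k * b" "Z = k * c"
proof -
  consider "a \<noteq> 0" | "b \<noteq> 0" | "c \<noteq> 0" using assms(1) by blast
  then show ?thesis
  proof cases
    case 1
    then show ?thesis using assms by (intro that[of "X / a"]) (simp_all add: field_simps)
  next
    case 2
    then show ?thesis using assms by (intro that[of "Y / b"]) (simp_all add: field_simps)
  next
    case 3
    then show ?thesis using assms by (intro that[of "Z / c"]) (simp_all add: field_simps)
  qed
qed

lemma circular_coordinates_cancel: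
  fixes r s :: complex
  shows "(r + s) / 2 + \<i> * (- \<i> * (r - s) / 2) = r" "(r + s) / 2 - \<i> * (- \<i> * (r - s) / 2) = s"
    "(- \<i> * (r - s) / 2)^2 = - ((r - s)^2 / 4)"
  by (simp_all add: field_simps power2_eq_square)

lemma circular_coordinates_mult: "(- \<i> * r / 2) * (- \<i> * s / 2) = - (r * s) / 4"
proof -
  have "(- \<i> * r / 2) * (- \<i> * s / 2) = (\<i> * \<i>) * (r * s) / 4"
    by (simp only: times_divide_eq_left times_divide_eq_right mult_ac
        minus_mult_left[symmetric] minus_mult_right[symmetric]) simp
  then show ?thesis by simp
qed

locale circle_and_parabola =
  fixes x y p :: real
  assumes p_nz: "p \<noteq> 0" and not_unit: "x^2 + y^2 - 1 \<noteq> 0"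
begin

text \<open>The value for which x + i y = U^2, x - i y = V^2, z = \<mu> (U - V)^2 satisfies the
  equation of the parabola identically.\<close>

definition \<mu> :: real where "\<mu> = - 1 / (2 * p)"

lemma \<mu>_nz: "\<mu> \<noteq> 0"
  using p_nz by (simp add: \<mu>_def)

lemma p_\<mu>: "of_real p * of_real \<mu> = (- 1 / 2 :: complex)"
proof -
  have "complex_of_real (p * \<mu>) = of_real (- 1 / 2)" using p_nz by (simp add: \<mu>_def)
  then show ?thesis by simp
qed

definition \<alpha>\<^sub>E :: complex where "\<alpha>\<^sub>E = of_real \<mu> * (of_real x + \<i> * of_real y)"
definition \<beta>\<^sub>E :: complex where "\<beta>\<^sub>E = of_real \<mu> * (of_real x - \<i> * of_real y)"
definition c\<^sub>E :: complex where "c\<^sub>E = of_real (\<mu>^2 * (x^2 + y^2 - 1))"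

lemma \<alpha>\<^sub>E_\<beta>\<^sub>E: "\<alpha>\<^sub>E * \<beta>\<^sub>E = of_real (\<mu>^2 * (x^2 + y^2))"
  by (simp add: \<alpha>\<^sub>E_def \<beta>\<^sub>E_def complex_eq_iff power2_eq_square algebra_simps)

sublocale tangent_pencil \<alpha>\<^sub>E \<beta>\<^sub>E c\<^sub>E
proof
  have "\<mu>^2 * (x^2 + y^2) \<noteq> \<mu>^2 * (x^2 + y^2 - 1)" using \<mu>_nz by simp
  then show "\<alpha>\<^sub>E * \<beta>\<^sub>E \<noteq> c\<^sub>E"
    unfolding \<alpha>\<^sub>E_\<beta>\<^sub>E c\<^sub>E_def using of_real_eq_iff by metis
  show "c\<^sub>E \<noteq> 0" unfolding c\<^sub>E_def of_real_eq_0_iff using \<mu>_nz not_unit by simp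
qed (simp_all add: \<alpha>\<^sub>E_def \<beta>\<^sub>E_def c\<^sub>E_def)

definition meet :: "hom_pair \<Rightarrow> hom_pair \<Rightarrow> complex^3" where
  "meet T S = vector [(fst T * fst S + snd T * snd S) / 2, - \<i> * (fst T * fst S - snd T * snd S) / 2,
     of_real \<mu> * ((fst T - snd T) * (fst S - snd S))]"

lemma meet_nth [simp]:
  "meet T S $ 1 = (fst T * fst S + snd T * snd S) / 2"
  "meet T S $ 2 = - \<i> * (fst T * fst S - snd T * snd S) / 2"
  "meet T S $ 3 = of_real \<mu> * ((fst T - snd T) * (fst S - snd S))"
  by (simp_all add: meet_def)

lemma meet_on_circle: "pairing (meet T S) (unit_circle (x, y) *v meet T S) = F T S"
proof -
  define r t z where "r = fst T * fst S" and "t = snd T * snd S"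
    and "z = (fst T - snd T) * (fst S - snd S)"
  have *: "meet T S $ 1 = (r + t) / 2" "(meet T S $ 2)^2 = - ((r - t)^2 / 4)"
    "meet T S $ 2 = - \<i> * (r - t) / 2" "meet T S $ 3 = of_real \<mu> * z"
    by (simp_all only: meet_nth r_def t_def z_def circular_coordinates_cancel(3))
  have "pairing (meet T S) (unit_circle (x, y) *v meet T S)
    = ((r + t) / 2)^2 - (r - t)^2 / 4
      - 2 * (of_real x * ((r + t) / 2) + of_real y * (- \<i> * (r - t) / 2)) * (of_real \<mu> * z)
      + (of_real x ^2 + of_real y ^2 - 1) * (of_real \<mu> * z)^2"
    unfolding pairing_unit_circle *(1) *(2) unfolding *(3,4) by (simp add: algebra_simps)
  also have "\<dots> = (r - of_real \<mu> * (of_real x + \<i> * of_real y) * z)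
       * (t - of_real \<mu> * (of_real x - \<i> * of_real y) * z)
     - (of_real \<mu> * (of_real x + \<i> * of_real y) * (of_real \<mu> * (of_real x - \<i> * of_real y))
         - of_real \<mu>^2 * (of_real x^2 + of_real y^2 - 1)) * z^2"
    by (simp add: field_simps power2_eq_square)
  also have "\<dots> = F T S"
    unfolding F_eq unfolding \<alpha>\<^sub>E_def \<beta>\<^sub>E_def c\<^sub>E_def r_def t_def z_def by (simp only: of_real_mult of_real_power of_real_diff of_real_add of_real_1)
  finally show ?thesis .
qed

lemma meet_on_tangent: "pairing (parabola p *v meet T T) (meet S R) = bracket T S * bracket T R / 2"
proof -
  obtain U V where T: "T = (U, V)" by fastforce
  obtain u v where S: "S = (u, v)" by fastforce
  obtain a b where R: "R = (a, b)" by fastforce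
  have "pairing (parabola p *v meet T T) (meet S R)
    = (- ((U * U - V * V) * (u * a - v * b))
       - 2 * (of_real p * of_real \<mu>) * ((U * U + V * V) * ((u - v) * (a - b))
           + ((U - V) * (U - V)) * (u * a + v * b))
       - 4 * (of_real p * of_real \<mu>)^2 * (((U - V) * (U - V)) * ((u - v) * (a - b)))) / 4"
    unfolding pairing_parabola meet_nth circular_coordinates_mult T S R fst_conv snd_conv
    by (simp add: add_divide_distrib diff_divide_distrib power2_eq_square algebra_simps)
  also have "\<dots> = bracket T S * bracket T R / 2"
    unfolding p_\<mu> bracket_def T S R fst_conv snd_conv
    by (simp add: power_divide add_divide_distrib diff_divide_distrib algebra_simps)
  finally show ?thesis .
qed

lemma meet_nz:
  assumes "T \<noteq> 0" "S \<noteq> 0"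
  shows "meet T S \<noteq> 0"
proof
  assume "meet T S = 0"
  then have m: "meet T S $ 1 = 0" "meet T S $ 2 = 0" "meet T S $ 3 = 0" by simp_all
  have "fst T * fst S = meet T S $ 1 + \<i> * meet T S $ 2"
    "snd T * snd S = meet T S $ 1 - \<i> * meet T S $ 2"
    unfolding meet_nth circular_coordinates_cancel by simp_all
  then have "fst T * fst S = 0" "snd T * snd S = 0" unfolding m by simp_all
  then have "fst T = 0 \<or> fst S = 0" "snd T = 0 \<or> snd S = 0" by simp_all
  moreover have "fst T = snd T \<or> fst S = snd S" using m(3) \<mu>_nz by simp
  moreover have "fst T \<noteq> 0 \<or> snd T \<noteq> 0" "fst S \<noteq> 0 \<or> snd S \<noteq> 0"
    using assms by (metis prod.collapse zero_prod_def)+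
  ultimately show False by metis
qed

text \<open>The components of \<open>T\<close> are square roots of x + i y and x - i y. The equation
  fixes the third coordinate up to the sign of their product, and this sign is absorbed into the
  second root.\<close>

lemma parabola_point:
  assumes "u \<noteq> 0" "pairing u (parabola p *v u) = 0"
  obtains T where "T \<noteq> 0" "u = meet T T"
proof -
  define X Y z where "X = u $ 1 + \<i> * u $ 2" and "Y = u $ 1 - \<i> * u $ 2" and "z = u $ 3 / of_real \<mu>"
  have u: "u $ 1 = (X + Y) / 2" "u $ 2 = - \<i> * (X - Y) / 2" "u $ 3 = of_real \<mu> * z"
    using \<mu>_nz by (simp_all add: X_def Y_def z_def)
  have "(u $ 2)^2 - 2 * (of_real p * of_real \<mu>) * (u $ 1 * z) - (of_real p * of_real \<mu>)^2 * z^2 = 0"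
    using assms(2) unfolding pairing_parabola_self pairing_parabola u(3)
    by (simp add: field_simps power2_eq_square)
  then have "(X + Y - z)^2 = 4 * (X * Y)"
    unfolding p_\<mu> u(1) u(2) circular_coordinates_cancel by (simp add: field_simps power2_eq_square) algebra
  moreover have "4 * (X * Y) = (2 * csqrt X * csqrt Y)^2" by (simp add: power_mult_distrib)
  ultimately have "X + Y - z = 2 * csqrt X * csqrt Y \<or> X + Y - z = 2 * csqrt X * (- csqrt Y)"
    by (simp add: power2_eq_iff)
  then obtain V where V: "V^2 = Y" "X + Y - z = 2 * csqrt X * V"
    by (metis power2_csqrt power2_minus)
  have "u = meet (csqrt X, V) (csqrt X, V)"
  proof -
    have "z = (csqrt X - V) * (csqrt X - V)"
      using V power2_csqrt[of X] by (simp add: algebra_simps power2_eq_square)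
    moreover have "csqrt X * csqrt X = X" "V * V = Y"
      using V(1) power2_csqrt[of X] by (simp_all add: power2_eq_square)
    ultimately show ?thesis
      by (simp add: vec3_eq_iff u)
  qed
  moreover have "(csqrt X, V) \<noteq> 0"
  proof
    assume "(csqrt X, V) = 0"
    then have "csqrt X = 0" "V = 0" by (simp_all add: zero_prod_def)
    then have "u = 0" using \<open>u = meet _ _\<close> by (simp add: vec3_eq_iff)
    with assms(1) show False ..
  qed
  ultimately show ?thesis using that by blast
qed

text \<open>Eliminating one coordinate at a time from the two line equations leaves each relation
  multiplied by \<open>bracket T S\<close>, which can be cancelled.\<close>

lemma common_point:
  assumes "bracket T S \<noteq> 0" "pairing (parabola p *v meet T T) w = 0" "pairing (parabola p *v meet S S) w = 0"
  obtains k where "w = k *s meet T S"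
proof -
  define X Y z where "X = w $ 1 + \<i> * w $ 2" and "Y = w $ 1 - \<i> * w $ 2" and "z = w $ 3 / of_real \<mu>"
  have w: "w $ 1 = (X + Y) / 2" "w $ 2 = - \<i> * (X - Y) / 2" "w $ 3 = of_real \<mu> * z"
    using \<mu>_nz by (simp_all add: X_def Y_def z_def)
  have on: "snd R * (snd R - fst R) * X + fst R * (fst R - snd R) * Y + fst R * snd R * z = 0"
    if "pairing (parabola p *v meet R R) w = 0" for R
  proof -
    obtain U V where R: "R = (U, V)" by fastforce
    have "pairing (parabola p *v meet R R) w
      = (- ((U * U - V * V) * (X - Y)) - 2 * (of_real p * of_real \<mu>) * ((U * U + V * V) * z
           + ((U - V) * (U - V)) * (X + Y)) - 4 * (of_real p * of_real \<mu>)^2 * (((U - V) * (U - V)) * z)) / 4"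
      unfolding pairing_parabola meet_nth w circular_coordinates_mult R fst_conv snd_conv
      by (simp add: add_divide_distrib diff_divide_distrib power2_eq_square algebra_simps)
    also have "\<dots> = (V * (V - U) * X + U * (U - V) * Y + U * V * z) / 2"
      unfolding p_\<mu>
      by (simp add: power_divide add_divide_distrib diff_divide_distrib algebra_simps)
    finally show ?thesis using that by (simp add: R)
  qed
  note eT = on[OF assms(2)] and eS = on[OF assms(3)]
  let ?U = "fst T" and ?V = "snd T" and ?u = "fst S" and ?v = "snd S"
  have "bracket T S * (X * (?V * ?v) - Y * (?U * ?u))
      = ?U * ?V * (?v * (?v - ?u) * X + ?u * (?u - ?v) * Y + ?u * ?v * z)
      - ?u * ?v * (?V * (?V - ?U) * X + ?U * (?U - ?V) * Y + ?U * ?V * z)"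
    unfolding bracket_def by algebra
  then have 1: "X * (?V * ?v) = Y * (?U * ?u)" unfolding eT eS using assms(1) by simp
  have "bracket T S * (X * ((?U - ?V) * (?u - ?v)) - z * (?U * ?u))
      = ?u * (?u - ?v) * (?V * (?V - ?U) * X + ?U * (?U - ?V) * Y + ?U * ?V * z)
      - ?U * (?U - ?V) * (?v * (?v - ?u) * X + ?u * (?u - ?v) * Y + ?u * ?v * z)"
    unfolding bracket_def by algebra
  then have 2: "X * ((?U - ?V) * (?u - ?v)) = z * (?U * ?u)" unfolding eT eS using assms(1) by simp
  have "bracket T S * (Y * ((?U - ?V) * (?u - ?v)) - z * (?V * ?v))
      = ?v * (?u - ?v) * (?V * (?V - ?U) * X + ?U * (?U - ?V) * Y + ?U * ?V * z)
      - ?V * (?U - ?V) * (?v * (?v - ?u) * X + ?u * (?u - ?v) * Y + ?u * ?v * z)"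
    unfolding bracket_def by algebra
  then have 3: "Y * ((?U - ?V) * (?u - ?v)) = z * (?V * ?v)" unfolding eT eS using assms(1) by simp
  have "?U * ?u \<noteq> 0 \<or> ?V * ?v \<noteq> 0 \<or> (?U - ?V) * (?u - ?v) \<noteq> 0"
    using assms(1) by (auto simp: bracket_def)
  then obtain k where k: "X = k * (?U * ?u)" "Y = k * (?V * ?v)" "z = k * ((?U - ?V) * (?u - ?v))"
    using proportional_triple[OF _ 1 2 3] by metis
  have "w = k *s meet T S"
    unfolding vec3_eq_iff w k vector_smult_component meet_nth by (simp add: field_simps)
  then show ?thesis by (rule that)
qed

lemma closing_iff_root: "closing \<longleftrightarrow> poly (Q7_4 x y) p = 0"
proof -
  define r C N where "r = x^2 + y^2" and "C = \<mu>^2 * (x^2 + y^2 - 1)" and "N = 2 * \<mu> * x * C - \<mu>^2 * r"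
  have \<nu>: "\<nu> = of_real N"
    unfolding \<nu>_def unfolding \<alpha>\<^sub>E_\<beta>\<^sub>E N_def r_def unfolding \<alpha>\<^sub>E_def \<beta>\<^sub>E_def c\<^sub>E_def C_def[symmetric]
    by (simp add: algebra_simps)
  have "closing \<longleftrightarrow> complex_of_real ((C - \<mu>^2 * r) * N * (N^2 + C^3)) = of_real (C^6)"
    unfolding closing_def \<nu> unfolding \<alpha>\<^sub>E_\<beta>\<^sub>E c\<^sub>E_def C_def[symmetric] unfolding r_def[symmetric] by simp
  also have "\<dots> \<longleftrightarrow> (C - \<mu>^2 * r) * N * (N^2 + C^3) = C^6"
    by (rule of_real_eq_iff)
  also have "\<dots> \<longleftrightarrow> \<mu>^12 * poly (Q7_4 x y) p = 0"
  proof -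
    have pm: "p * \<mu> = - 1 / 2" using p_nz by (simp add: \<mu>_def)
    \<comment> \<open>The factor supplies a power of \<mu> for every power of p, so p enters only
      through p \<mu> = - 1 / 2.\<close>
    have "\<mu>^12 * poly (Q7_4 x y) p = 16 * r^3 * \<mu>^8 * (p * \<mu>)^4 + 48 * x * r^2 * (r - 1) * \<mu>^9 * (p * \<mu>)^3
        + 4 * r * (r - 1)^2 * (12 * x^2 + r - 1) * \<mu>^10 * (p * \<mu>)^2
        + 4 * x * (r - 1)^3 * (4 * x^2 + r - 1) * \<mu>^11 * (p * \<mu>) - (r - 1)^6 * \<mu>^12"
      unfolding Q7_4_def r_def by (simp add: poly_monom) algebra
    also have "\<dots> = (C - \<mu>^2 * r) * N * (N^2 + C^3) - C^6"
      unfolding pm N_def C_def r_def[symmetric] by (simp add: field_simps) algebra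
    finally show ?thesis by simp
  qed
  finally show ?thesis using \<mu>_nz by simp
qed

section \<open>Chains of parameters versus Poncelet polygons in the projective plane\<close>

definition tangent :: "hom_pair \<Rightarrow> cp2 set" where
  "tangent T = proj_line (parabola p *v meet T T)"

lemma meet_mem_tangent:
  "S \<noteq> 0 \<Longrightarrow> R \<noteq> 0 \<Longrightarrow> abs_cp2 (meet S R) \<in> tangent T \<longleftrightarrow> bracket T S = 0 \<or> bracket T R = 0"
  by (simp add: tangent_def abs_cp2_mem_proj_line meet_nz meet_on_tangent)

lemma tangent_eqD: "S \<noteq> 0 \<Longrightarrow> tangent T = tangent S \<Longrightarrow> bracket T S = 0"
  using meet_mem_tangent[of S S T] meet_mem_tangent[of S S S] by simp

lemma tangent_to_parabola_iff:
  "tangent_to_conic l (parabola p) \<longleftrightarrow> (\<exists>T. T \<noteq> 0 \<and> l = tangent T)"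
proof
  assume "tangent_to_conic l (parabola p)"
  then obtain P where P: "P \<in> conic_points (parabola p)" "l = tangent_line_at (parabola p) P"
    unfolding tangent_to_conic_def by blast
  obtain u where u: "u \<noteq> 0" "P = abs_cp2 u" by (rule cp2_cases)
  with P(1) have "pairing u (parabola p *v u) = 0" by (simp add: abs_cp2_mem_conic)
  then obtain T where "T \<noteq> 0" "u = meet T T" using parabola_point u(1) by blast
  with P(2) u show "\<exists>T. T \<noteq> 0 \<and> l = tangent T"
    by (intro exI[of _ T]) (simp add: tangent_def tangent_line_at_abs)
next
  assume "\<exists>T. T \<noteq> 0 \<and> l = tangent T"
  then obtain T where T: "T \<noteq> 0" "l = tangent T" by blast
  have "abs_cp2 (meet T T) \<in> conic_points (parabola p)"
    using T(1) by (simp add: abs_cp2_mem_conic meet_nz pairing_parabola_self meet_on_tangent)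
  then show "tangent_to_conic l (parabola p)"
    unfolding tangent_to_conic_def using T
    by (intro bexI[of _ "abs_cp2 (meet T T)"]) (simp_all add: tangent_def tangent_line_at_abs meet_nz)
qed

lemma is_line_tangent:
  assumes "T \<noteq> 0"
  shows "is_line (tangent T)"
proof -
  obtain S where "bracket T S \<noteq> 0"
  proof (cases "fst T = 0")
    case True
    then show ?thesis using assms that[of "(1, 0)"] by (simp add: bracket_def prod_eq_iff)
  next
    case False
    then show ?thesis using that[of "(0, 1)"] by (simp add: bracket_def)
  qed
  then have "pairing (parabola p *v meet T T) (meet S S) \<noteq> 0" by (simp add: meet_on_tangent)
  then have "parabola p *v meet T T \<noteq> 0" by (auto simp: pairing_def)
  then show ?thesis unfolding is_line_def tangent_def by blast
qed

lemma meet_on_circle_of_vertex: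
  assumes "T \<noteq> 0" "S \<noteq> 0" "bracket T S \<noteq> 0" "P \<in> tangent T" "P \<in> tangent S"
    "P \<in> conic_points (unit_circle (x, y))"
  shows "F T S = 0"
proof -
  obtain w where w: "w \<noteq> 0" "P = abs_cp2 w" by (rule cp2_cases)
  have "pairing (parabola p *v meet T T) w = 0" "pairing (parabola p *v meet S S) w = 0"
    using assms(4,5) w by (simp_all add: tangent_def abs_cp2_mem_proj_line)
  then obtain k where k: "w = k *s meet T S" using common_point[OF assms(3)] by blast
  with w(1) have "k \<noteq> 0" by auto
  moreover have "k * (k * F T S) = 0"
    using assms(6) w by (simp add: abs_cp2_mem_conic k matrix_vector_scale meet_on_circle)
  ultimately show ?thesis by simp
qed

lemma closing_of_poncelet:
  assumes "poncelet_polygon 7 (unit_circle (x, y)) (parabola p) v l"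
  shows closing
proof -
  have inj: "inj_on l {..<7}"
    and side: "\<And>i. i < 7 \<Longrightarrow> v i \<in> l i \<and> v (Suc i mod 7) \<in> l i \<and>
      v i \<in> conic_points (unit_circle (x, y)) \<and> tangent_to_conic (l i) (parabola p)"
    using assms unfolding poncelet_polygon_def by auto
  have "\<forall>i. \<exists>T. i < 7 \<longrightarrow> T \<noteq> 0 \<and> l i = tangent T"
    using side tangent_to_parabola_iff by blast
  then obtain T where T: "\<And>i. i < 7 \<Longrightarrow> T i \<noteq> 0" "\<And>i. i < 7 \<Longrightarrow> l i = tangent (T i)"
    by metis
  define t where "t j = T (j mod 7)" for j
  have nz: "t j \<noteq> 0" for j using T(1) by (simp add: t_def)
  have distinct: "bracket (t i) (t j) \<noteq> 0" if "i mod 7 \<noteq> j mod 7" for i j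
  proof
    assume "bracket (t i) (t j) = 0"
    then obtain k where k: "k \<noteq> 0" "t j = (k * fst (t i), k * snd (t i))"
      using bracket_eq_0_scale[OF _ nz nz] by metis
    have "meet (t j) (t j) = k^2 *s meet (t i) (t i)"
      by (simp add: vec3_eq_iff k(2) power2_eq_square algebra_simps)
    then have "tangent (t j) = tangent (t i)"
      using k(1) by (simp add: tangent_def matrix_vector_scale proj_line_smult)
    then have "l (i mod 7) = l (j mod 7)" using T(2) by (simp add: t_def)
    then show False using inj that by (simp add: inj_on_def)
  qed
  have edge: "F (t j) (t (j + 1)) = 0" for j
  proof (rule meet_on_circle_of_vertex[OF nz nz])
    show "bracket (t j) (t (j + 1)) \<noteq> 0" by (rule distinct) (simp add: mod_Suc)
    have "Suc (j mod 7) mod 7 = (j + 1) mod 7" by (simp add: mod_Suc_eq)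
    then show "v ((j + 1) mod 7) \<in> tangent (t j)"
      using side[of "j mod 7"] T(2)[of "j mod 7"] by (simp add: t_def)
    show "v ((j + 1) mod 7) \<in> tangent (t (j + 1))"
      "v ((j + 1) mod 7) \<in> conic_points (unit_circle (x, y))"
      using side[of "(j + 1) mod 7"] T(2)[of "(j + 1) mod 7"] by (simp_all add: t_def)
  qed
  interpret tangent_polygon \<alpha>\<^sub>E \<beta>\<^sub>E c\<^sub>E t
    by unfold_locales (use nz distinct edge in \<open>simp_all add: t_def\<close>)
  show ?thesis by (rule closing_of_polygon)
qed

text \<open>Side \<open>j\<close> must join the vertices \<open>j\<close> and \<open>j + 1\<close>,
  so vertex \<open>j\<close> is the meeting point of sides \<open>j - 1\<close> and
  \<open>j\<close>; integer indices let this wrap around at 0.\<close>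

lemma poncelet_of_closing:
  assumes closing
  shows "poncelet_polygon 7 (unit_circle (x, y)) (parabola p)
    (\<lambda>j. abs_cp2 (meet (cyc (int j - 1)) (cyc (int j)))) (\<lambda>j. tangent (cyc (int j)))"
proof -
  have distinct: "i mod 7 = j mod 7" if "bracket (cyc i) (cyc j) = 0" for i j :: int
    using cyc_distinct[OF assms that] .
  have cyc_mod: "cyc (int (Suc i mod 7)) = cyc (int i + 1)" "cyc (int (Suc i mod 7) - 1) = cyc (int i)" for i
  proof -
    have eq: "int (Suc i mod 7) = (int i + 1) mod 7" by (simp add: zmod_int add.commute)
    show "cyc (int (Suc i mod 7)) = cyc (int i + 1)" "cyc (int (Suc i mod 7) - 1) = cyc (int i)"
      unfolding eq by (rule cyc_cong, simp add: mod_diff_left_eq)+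
  qed
  have "F (cyc (i - 1)) (cyc i) = 0" for i
    using vieta_root_iff[OF cyc_vieta[OF assms, of "i - 1"], of "cyc i"] by simp
  then have circle: "abs_cp2 (meet (cyc (i - 1)) (cyc i)) \<in> conic_points (unit_circle (x, y))" for i
    by (simp add: abs_cp2_mem_conic meet_nz cyc_nz meet_on_circle)
  have "inj_on (\<lambda>j. tangent (cyc (int j))) {..<7}"
  proof (rule inj_onI)
    fix i j :: nat
    assume ij: "i \<in> {..<7}" "j \<in> {..<7}" and "tangent (cyc (int i)) = tangent (cyc (int j))"
    then have "int i mod 7 = int j mod 7" using tangent_eqD[OF cyc_nz] distinct by blast
    with ij show "i = j" by simp
  qed
  moreover have "inj_on (\<lambda>j. abs_cp2 (meet (cyc (int j - 1)) (cyc (int j)))) {..<7}"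
  proof (rule inj_onI)
    fix i j :: nat
    assume ij: "i \<in> {..<7}" "j \<in> {..<7}"
      and eq: "abs_cp2 (meet (cyc (int i - 1)) (cyc (int i))) = abs_cp2 (meet (cyc (int j - 1)) (cyc (int j)))"
    \<comment> \<open>A vertex determines which members of the chain pass through it, so equal
      vertices have the same pair of sides.\<close>
    have mem: "bracket (cyc k) (cyc (int i - 1)) = 0 \<or> bracket (cyc k) (cyc (int i)) = 0 \<longleftrightarrow>
        bracket (cyc k) (cyc (int j - 1)) = 0 \<or> bracket (cyc k) (cyc (int j)) = 0" for k
      using meet_mem_tangent[OF cyc_nz cyc_nz] eq by metis
    have "int i mod 7 = (int j - 1) mod 7 \<or> int i mod 7 = int j mod 7"
      using mem[of "int i"] distinct by auto
    moreover have "int j mod 7 = (int i - 1) mod 7 \<or> int j mod 7 = int i mod 7"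
      using mem[of "int j"] distinct by auto
    moreover have "int i mod 7 = int i" "int j mod 7 = int j"
      "(int i - 1) mod 7 = (if i = 0 then 6 else int i - 1)" "(int j - 1) mod 7 = (if j = 0 then 6 else int j - 1)"
      using ij by (auto simp: minus_mod_eq_div_mult)
    ultimately show "i = j" using ij by (auto split: if_splits)
  qed
  moreover have "is_line (tangent (cyc (int i)))" "tangent_to_conic (tangent (cyc (int i))) (parabola p)" for i
    using is_line_tangent tangent_to_parabola_iff cyc_nz by blast+
  moreover have "abs_cp2 (meet (cyc (int i - 1)) (cyc (int i))) \<in> tangent (cyc (int i))"
    "abs_cp2 (meet (cyc (int i)) (cyc (int i + 1))) \<in> tangent (cyc (int i))" for i
    using meet_mem_tangent cyc_nz by simp_all
  ultimately show ?thesis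
    unfolding poncelet_polygon_def using circle by (simp add: cyc_mod)
qed

lemma poncelet_pair_iff: "poncelet_pair 7 (unit_circle (x, y)) (parabola p) \<longleftrightarrow> poly (Q7_4 x y) p = 0"
  unfolding closing_iff_root[symmetric] poncelet_pair_def
  using closing_of_poncelet poncelet_of_closing smooth_conic_unit_circle smooth_conic_parabola[OF p_nz]
  by auto

end

section \<open>Real roots of the quartic\<close>

definition normal_quartic :: "real \<Rightarrow> real \<Rightarrow> real \<Rightarrow> real" where
  "normal_quartic x k u = u * (u - 2 * x) * (u^2 + k) - k^2 * (k + 1)"

lemma poly_Q7_4:
  fixes x y p :: real
  defines "r \<equiv> x^2 + y^2" and "k \<equiv> x^2 + y^2 - 1"
  assumes "r \<noteq> 0" "k \<noteq> 0"
  shows "poly (Q7_4 x y) p = k^4 / r * normal_quartic x k (2 * x + 2 * r * p / k)"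
proof -
  define q where "q = p / k"
  have p: "p = q * k" using assms(4) by (simp add: q_def)
  have yr: "y^2 = r - x^2" and k: "k = r - 1" by (simp_all add: r_def k_def)
  have "r * poly (Q7_4 x y) p = r * (16 * r^3 * p^4 + 48 * x * r^2 * k * p^3
     + 4 * r * k^2 * (12 * x^2 + k) * p^2 + 4 * x * k^3 * (4 * x^2 + k) * p - k^6)"
    unfolding Q7_4_def by (simp add: poly_monom yr k algebra_simps)
  also have "\<dots> = k^4 * normal_quartic x k (2 * x + 2 * r * q)"
    unfolding normal_quartic_def p k by algebra
  finally show ?thesis
    using assms(3) by (simp add: q_def field_simps)
qed

text \<open>Division by (u - a) (u - b): the remainder is linear and vanishes at two points.\<close>

lemma quartic_factorization:
  fixes a b :: real
  assumes "a \<noteq> b" "a^4 + c3 * a^3 + c2 * a^2 + c1 * a + c0 = 0"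
    "b^4 + c3 * b^3 + c2 * b^2 + c1 * b + c0 = 0"
  obtains e f where "c3 = e - (a + b)" "c2 = f - e * (a + b) + a * b"
    "c1 = e * (a * b) - f * (a + b)" "c0 = a * b * f"
proof -
  define e where "e = c3 + a + b"
  define f where "f = c2 + e * (a + b) - a * b"
  define r1 where "r1 = c1 - (e * (a * b) - f * (a + b))"
  define r0 where "r0 = c0 - a * b * f"
  have c: "c3 = e - (a + b)" "c2 = f - e * (a + b) + a * b"
    "c1 = r1 + (e * (a * b) - f * (a + b))" "c0 = r0 + a * b * f"
    by (simp_all add: e_def f_def r1_def r0_def)
  have *: "u^4 + c3 * u^3 + c2 * u^2 + c1 * u + c0
      = (u - a) * (u - b) * (u^2 + e * u + f) + (r1 * u + r0)" for u
    unfolding c by algebra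
  have "r1 * a + r0 = 0" "r1 * b + r0 = 0"
    using assms(2,3) unfolding * by simp_all
  moreover from this have "r1 * (a - b) = 0" by algebra
  ultimately have "r1 = 0" "r0 = 0" using assms(1) by auto
  then show ?thesis using c by (intro that[of e f]) simp_all
qed

text \<open>The discriminant of u^4 + b u^3 + c u^2 + d u + e.\<close>

definition disc4 :: "real \<Rightarrow> real \<Rightarrow> real \<Rightarrow> real \<Rightarrow> real" where
  "disc4 b c d e =
     256*e^3 - 192*b*d*e^2 - 128*c^2*e^2 + 144*c*d^2*e - 27*d^4 + 144*b^2*c*e^2 - 6*b^2*d^2*e
     - 80*b*c^2*d*e + 18*b*c*d^3 + 16*c^4*e - 4*c^3*d^2 - 27*b^4*e^2 + 18*b^3*c*d*e - 4*b^3*d^3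
     - 4*b^2*c^3*e + b^2*c^2*d^2"

text \<open>The factor in front of \<open>e^2 - 4 * f\<close> is a square, so the sign of the
  discriminant tells whether the remaining quadratic has real roots, and a nonzero value separates
  them from \<open>a\<close> and \<open>b\<close>.\<close>

lemma disc4_factored:
  "disc4 (e - (a + b)) (f - e * (a + b) + a * b) (e * (a * b) - f * (a + b)) (a * b * f)
   = (a - b)^2 * ((a^2 + e * a + f) * (b^2 + e * b + f))^2 * (e^2 - 4 * f)"
  unfolding disc4_def by algebra

lemma disc4_Psi_1:
  fixes x y :: real
  defines "k \<equiv> x^2 + y^2 - 1"
  shows "disc4 (- 2 * x) k (- 2 * x * k) (- (k^2 * (k + 1))) = - 16 * k^3 * Psi_1 x y"
  unfolding disc4_def Psi_1_def k_def by algebra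

lemma normal_quartic_expand: "normal_quartic x k u = u^4 + (- 2 * x) * u^3 + k * u^2 + (- 2 * x * k) * u + (- (k^2 * (k + 1)))"
  unfolding normal_quartic_def by algebra

lemma normal_quartic_0_neg: "k \<noteq> 0 \<Longrightarrow> k > - 1 \<Longrightarrow> normal_quartic x k 0 < 0"
  by (simp add: normal_quartic_def zero_less_mult_iff)

text \<open>The summands of the bound ensure, in turn, that the factor u - 2 x is at least 1 in
  absolute value, that u^2 + k is at least 1, and that the product exceeds the constant
  term.\<close>

lemma normal_quartic_large_pos:
  assumes "k > - 1"
  shows "normal_quartic x k (2 * \<bar>x\<bar> + 1 + \<bar>k\<bar> + k^2 * (k + 1)) > 0"
    and "normal_quartic x k (- (2 * \<bar>x\<bar> + 1 + \<bar>k\<bar> + k^2 * (k + 1))) > 0"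
proof -
  define M where "M = 2 * \<bar>x\<bar> + 1 + \<bar>k\<bar> + k^2 * (k + 1)"
  have c: "k^2 * (k + 1) \<ge> 0" using assms by simp
  have M: "M \<ge> 1 + \<bar>k\<bar>" "M \<ge> 1" "M \<ge> 1 + k^2 * (k + 1)" using c by (simp_all add: M_def)
  have "M * 1 \<le> M * M" using M(2) by (intro mult_left_mono) auto
  then have q: "M^2 + k \<ge> 1" using M(1) by (simp add: power2_eq_square)
  have large: "M * t * (M^2 + k) - k^2 * (k + 1) > 0" if "t \<ge> 1" for t
  proof -
    have "M * 1 \<le> M * t" using M(2) that by (intro mult_left_mono) auto
    then have "M * 1 * 1 \<le> M * t * (M^2 + k)"
      using q M(2) by (intro mult_mono) auto
    then show ?thesis using M(3) by simp
  qed
  have "M - 2 * x \<ge> 1" "M + 2 * x \<ge> 1" using c by (simp_all add: M_def)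
  then show "normal_quartic x k (2 * \<bar>x\<bar> + 1 + \<bar>k\<bar> + k^2 * (k + 1)) > 0"
    "normal_quartic x k (- (2 * \<bar>x\<bar> + 1 + \<bar>k\<bar> + k^2 * (k + 1))) > 0"
    using large[of "M - 2 * x"] large[of "M + 2 * x"] unfolding M_def[symmetric] normal_quartic_def
    by (simp_all add: algebra_simps)
qed

text \<open>The quartic is negative at 0 and positive far out on both sides, which gives one root of
  each sign; the remaining quadratic decides the count.\<close>

lemma normal_quartic_factorization:
  assumes "k \<noteq> 0" "k > - 1"
  obtains a b e f where "a < 0" "0 < b"
    "\<And>u. normal_quartic x k u = (u - a) * (u - b) * (u^2 + e * u + f)"
    "disc4 (- 2 * x) k (- 2 * x * k) (- (k^2 * (k + 1)))
     = (a - b)^2 * ((a^2 + e * a + f) * (b^2 + e * b + f))^2 * (e^2 - 4 * f)"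
proof -
  define M where "M = 2 * \<bar>x\<bar> + 1 + \<bar>k\<bar> + k^2 * (k + 1)"
  have M: "M > 0" using assms by (simp add: M_def add_pos_nonneg)
  have cont: "continuous_on S (normal_quartic x k)" for S
    unfolding normal_quartic_def by (intro continuous_intros)
  have "normal_quartic x k 0 \<le> 0" "0 \<le> normal_quartic x k M" "0 \<le> normal_quartic x k (- M)" "0 \<le> M" "- M \<le> 0"
    using normal_quartic_0_neg[OF assms, of x] normal_quartic_large_pos[OF assms(2), of x] M unfolding M_def by linarith+
  note M' = this
  obtain b where b: "0 \<le> b" "normal_quartic x k b = 0"
    using IVT'[OF M'(1,2,4) cont] by blast
  obtain a where a: "a \<le> 0" "normal_quartic x k a = 0"
    using IVT2'[OF M'(1,3,5) cont] by blast
  have nz: "a \<noteq> 0" "b \<noteq> 0" using a b normal_quartic_0_neg[OF assms, of x] by auto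
  then have "a \<noteq> b" using a b by simp
  then obtain e f where ef: "- 2 * x = e - (a + b)" "k = f - e * (a + b) + a * b"
    "- 2 * x * k = e * (a * b) - f * (a + b)" "- (k^2 * (k + 1)) = a * b * f"
    by (rule quartic_factorization[OF _ a(2)[unfolded normal_quartic_expand] b(2)[unfolded normal_quartic_expand]])
  show ?thesis
  proof (rule that[of a b e f])
    show "a < 0" "0 < b" using a b nz by simp_all
    have d: "disc4 A B C D = (a - b)^2 * ((a^2 + e * a + f) * (b^2 + e * b + f))^2 * (e^2 - 4 * f)"
      if "A = e - (a + b)" "B = f - e * (a + b) + a * b" "C = e * (a * b) - f * (a + b)" "D = a * b * f"
      for A B C D unfolding that by (rule disc4_factored)
    show "disc4 (- 2 * x) k (- 2 * x * k) (- (k^2 * (k + 1)))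
     = (a - b)^2 * ((a^2 + e * a + f) * (b^2 + e * b + f))^2 * (e^2 - 4 * f)"
      by (rule d[OF ef])
    have g: "u^4 + A * u^3 + B * u^2 + C * u + D = (u - a) * (u - b) * (u^2 + e * u + f)"
      if "A = e - (a + b)" "B = f - e * (a + b) + a * b" "C = e * (a * b) - f * (a + b)" "D = a * b * f"
      for A B C D u unfolding that by algebra
    show "normal_quartic x k u = (u - a) * (u - b) * (u^2 + e * u + f)" for u
      unfolding normal_quartic_expand by (rule g[OF ef])
  qed
qed

lemma quadratic_pos:
  fixes e f u :: real
  assumes "e^2 < 4 * f"
  shows "u^2 + e * u + f > 0"
proof -
  have "4 * (u^2 + e * u + f) = (2 * u + e)^2 + (4 * f - e^2)" by algebra
  also have "\<dots> > 0" using assms by (intro add_nonneg_pos) auto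
  finally show ?thesis by simp
qed

lemma quadratic_split:
  fixes e f :: real
  assumes "4 * f \<le> e^2"
  obtains v w where "v + w = - e" "v * w = f" "(v - w)^2 = e^2 - 4 * f"
proof (rule that)
  let ?s = "sqrt (e^2 - 4 * f)"
  have s: "?s^2 = e^2 - 4 * f" using assms by simp
  show "(- e + ?s) / 2 + (- e - ?s) / 2 = - e" by (simp add: field_simps)
  show "(- e + ?s) / 2 * ((- e - ?s) / 2) = f"
    using s by (simp add: field_simps power2_eq_square)
  have "(- e + ?s) / 2 - (- e - ?s) / 2 = ?s" by (simp add: field_simps)
  then show "((- e + ?s) / 2 - (- e - ?s) / 2)^2 = e^2 - 4 * f" using s by simp
qed

text \<open>The coefficient of u is the product of those of u^3 and u^2. For (u - d)^3 (u - m) this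
  relation is d times a positive definite form in d and m, and d is nonzero by the constant
  term.\<close>

lemma normal_quartic_no_triple_root:
  assumes "k \<noteq> 0" "k > - 1"
  shows "\<not> (\<forall>u. normal_quartic x k u = (u - d)^3 * (u - m))"
proof
  assume eq: "\<forall>u. normal_quartic x k u = (u - d)^3 * (u - m)"
  have *: "(c3 + (3 * d + m)) * u^3 + (c2 - (3 * d^2 + 3 * d * m)) * u^2
      + (c1 + (d^3 + 3 * d^2 * m)) * u + (c0 - d^3 * m) = 0"
    if "u^4 + c3 * u^3 + c2 * u^2 + c1 * u + c0 = (u - d)^3 * (u - m)" for u c3 c2 c1 c0
    using that by algebra
  \<comment> \<open>Four values determine a cubic.\<close>
  have coeffs: "c0 = 0 \<and> c1 = 0 \<and> c2 = 0 \<and> c3 = 0"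
    if "\<And>u. c3 * u^3 + c2 * u^2 + c1 * u + c0 = 0" for c0 c1 c2 c3 :: real
    using that[of 0] that[of 1] that[of "-1"] that[of 2] by simp
  have "- (k^2 * (k + 1)) - d^3 * m = 0 \<and> - 2 * x * k + (d^3 + 3 * d^2 * m) = 0 \<and>
      k - (3 * d^2 + 3 * d * m) = 0 \<and> - 2 * x + (3 * d + m) = 0"
    by (rule coeffs, rule *, rule eq[unfolded normal_quartic_expand, rule_format])
  then have c: "- (k^2 * (k + 1)) = d^3 * m" "2 * x * k = d^3 + 3 * d^2 * m"
    "k = 3 * d^2 + 3 * d * m" "2 * x = 3 * d + m"
    by linarith+
  have "(3 * d + m) * (3 * d^2 + 3 * d * m) = d^3 + 3 * d^2 * m"
    using c(2) by (simp only: c(3) c(4))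
  then have "d * (8 * d^2 + 9 * d * m + 3 * m^2) = 0" by algebra
  moreover have "d \<noteq> 0" using c(1) assms by auto
  moreover have "12 * (8 * d^2 + 9 * d * m + 3 * m^2) = (9 * d + 6 * m)^2 + 15 * d^2" by algebra
  ultimately have "(9 * d + 6 * m)^2 + 15 * d^2 = 0" by simp
  then show False using \<open>d \<noteq> 0\<close> by (simp add: add_nonneg_eq_0_iff)
qed

lemma normal_quartic_root_outside:
  assumes "k > 0" "normal_quartic x k v = 0"
  shows "v * (v - 2 * x) > 0"
proof -
  have "v * (v - 2 * x) * (v^2 + k) = k^2 * (k + 1)" using assms(2) by (simp add: normal_quartic_def)
  also have "\<dots> > 0" using assms(1) by simp
  finally have "v * (v - 2 * x) * (v^2 + k) > 0" .
  moreover have "v^2 + k > 0" using assms(1) by (simp add: add_nonneg_pos)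
  ultimately show ?thesis by (rule zero_less_mult_pos2)
qed

lemma normal_quartic_strict_mono:
  assumes "k > 0" "0 < v" "2 * x < v" "v < w"
  shows "normal_quartic x k v < normal_quartic x k w"
proof -
  have "v * (v - 2 * x) < w * (w - 2 * x)" using assms by (intro mult_strict_mono) auto
  moreover have "v^2 + k < w^2 + k" using assms by (simp add: power_strict_mono)
  ultimately have "v * (v - 2 * x) * (v^2 + k) < w * (w - 2 * x) * (w^2 + k)"
    using assms by (intro mult_strict_mono) (auto simp: zero_le_mult_iff)
  then show ?thesis by (simp add: normal_quartic_def)
qed

lemma normal_quartic_reflect: "normal_quartic x k (- u) = normal_quartic (- x) k u"
  by (simp add: normal_quartic_def algebra_simps)

text \<open>For positive k all roots lie outside the interval between 0 and 2 x. To its right the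
  quartic is a product of increasing positive factors minus a constant, and reflection treats the
  left, so each sign occurs for one root only.\<close>

lemma normal_quartic_inj_root:
  assumes "k > 0" "normal_quartic x k v = 0" "normal_quartic x k w = 0" "0 < v * w"
  shows "v = w"
proof -
  have aux: "v' = w'" if "0 < v'" "0 < w'" "normal_quartic x' k v' = 0" "normal_quartic x' k w' = 0" for x' v' w'
    using normal_quartic_root_outside[OF assms(1) that(3)] normal_quartic_root_outside[OF assms(1) that(4)]
      normal_quartic_strict_mono[OF assms(1), of v' x' w'] normal_quartic_strict_mono[OF assms(1), of w' x' v'] that
    by (cases v' w' rule: linorder_cases) (auto simp: zero_less_mult_iff)
  show ?thesis
  proof (cases "0 < v")
    case True
    then show ?thesis using assms aux[of v w x] by (simp add: zero_less_mult_iff)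
  next
    case False
    then show ?thesis
      using assms aux[of "- v" "- w" "- x"] by (auto simp: zero_less_mult_iff normal_quartic_reflect)
  qed
qed

text \<open>At a double root the derivative vanishes, but v times the derivative is a sum with a
  positive and a nonnegative term because v (v - 2 x) is positive.\<close>

lemma normal_quartic_derivative_nz:
  assumes "k > 0" "\<And>u. normal_quartic x k u = (u - v)^2 * (u^2 + e * u + f)"
  shows False
proof -
  have root: "normal_quartic x k v = 0" using assms(2)[of v] by simp
  have fun_eq: "normal_quartic x k = (\<lambda>u. (u - v)^2 * (u^2 + e * u + f))" by (rule ext) (rule assms(2))
  have "((\<lambda>u. u * (u - 2 * x) * (u^2 + k) - k^2 * (k + 1)) has_real_derivative
      (v - 2 * x + v) * (v^2 + k) + v * (v - 2 * x) * (2 * v)) (at v)"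
    by (auto intro!: derivative_eq_intros simp: algebra_simps)
  then have d1: "(normal_quartic x k has_real_derivative
      (v - 2 * x + v) * (v^2 + k) + v * (v - 2 * x) * (2 * v)) (at v)"
    unfolding normal_quartic_def .
  have "((\<lambda>u. (u - v)^2 * (u^2 + e * u + f)) has_real_derivative 0) (at v)"
    by (rule derivative_eq_intros refl)+ simp
  then have d2: "(normal_quartic x k has_real_derivative 0) (at v)" unfolding fun_eq .
  have "(v - 2 * x + v) * (v^2 + k) + v * (v - 2 * x) * (2 * v) = 0"
    by (rule DERIV_unique[OF d1 d2])
  then have "v * ((v - 2 * x + v) * (v^2 + k) + v * (v - 2 * x) * (2 * v)) = 0" by simp
  then have z: "(v * (v - 2 * x) + v^2) * (v^2 + k) + v * (v - 2 * x) * (2 * v^2) = 0"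
    by (simp add: algebra_simps power2_eq_square)
  have "v * (v - 2 * x) > 0" by (rule normal_quartic_root_outside[OF assms(1) root])
  moreover have "v^2 + k > 0" using assms(1) by (simp add: add_nonneg_pos)
  moreover have "(t + v^2) * (v^2 + k) + t * (2 * v^2) > 0" if "t > 0" "v^2 + k > 0" for t
  proof -
    have "t + v^2 > 0" using that(1) by (intro add_pos_nonneg) auto
    then have "(t + v^2) * (v^2 + k) > 0" using that(2) by (rule mult_pos_pos)
    moreover have "t * (2 * v^2) \<ge> 0" using that(1) by simp
    ultimately show ?thesis by (rule add_pos_nonneg)
  qed
  ultimately show False using z by (metis less_irrefl)
qed

text \<open>A further real root would share its sign with \<open>a\<close> or \<open>b\<close>,
  hence equal it and be a double root.\<close>

lemma normal_quartic_two_roots_outside: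
  assumes "k > 0" "a < 0" "0 < b" "\<And>u. normal_quartic x k u = (u - a) * (u - b) * (u^2 + e * u + f)"
  shows "e^2 < 4 * f"
proof (rule ccontr)
  assume "\<not> e^2 < 4 * f"
  then have "4 * f \<le> e^2" by simp
  then obtain v w where vw: "v + w = - e" "v * w = f" "(v - w)^2 = e^2 - 4 * f"
    by (rule quadratic_split)
  then have e: "e = - (v + w)" and f: "f = v * w" by linarith+
  have q: "u^2 + e * u + f = (u - v) * (u - w)" for u unfolding e f by algebra
  have r: "normal_quartic x k a = 0" "normal_quartic x k b = 0" "normal_quartic x k v = 0" unfolding assms(4) q by simp_all
  have "v \<noteq> 0" using normal_quartic_root_outside[OF assms(1) r(3)] by auto
  then consider "0 < v * a" | "0 < v * b"
    using assms(2,3) mult_neg_neg[of v a] mult_pos_pos[of v b] by linarith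
  then have "v = a \<or> v = b" using normal_quartic_inj_root[OF assms(1) r(3)] r by cases auto
  then show False
  proof
    assume v: "v = a"
    have "normal_quartic x k u = (u - a)^2 * (u^2 + (- b - w) * u + b * w)" for u
      unfolding assms(4) q v by algebra
    then show False by (rule normal_quartic_derivative_nz[OF assms(1)])
  next
    assume v: "v = b"
    have "normal_quartic x k u = (u - b)^2 * (u^2 + (- a - w) * u + a * w)" for u
      unfolding assms(4) q v by algebra
    then show False by (rule normal_quartic_derivative_nz[OF assms(1)])
  qed
qed

section \<open>Root patterns of the quartic in the three regions\<close>

context
  fixes x y k :: real
  assumes k: "k = x^2 + y^2 - 1" and k_nz: "k \<noteq> 0" and k_gt: "k > - 1"
begin

lemma disc: "disc4 (- 2 * x) k (- 2 * x * k) (- (k^2 * (k + 1))) = - 16 * (k^3 * Psi_1 x y)"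
  using disc4_Psi_1[of x y] unfolding k[symmetric] by (simp only: mult.assoc)

text \<open>For positive k monotonicity decides; for negative k the discriminant is
  negative.\<close>

lemma normal_quartic_roots_simple_pair:
  assumes "Psi_1 x y < 0 \<or> k > 0"
  obtains a b where "a \<noteq> b" "{u. normal_quartic x k u = 0} = {a, b}"
proof -
  obtain a b e f where f: "a < 0" "0 < b"
    "\<And>u. normal_quartic x k u = (u - a) * (u - b) * (u^2 + e * u + f)"
    "disc4 (- 2 * x) k (- 2 * x * k) (- (k^2 * (k + 1)))
     = (a - b)^2 * ((a^2 + e * a + f) * (b^2 + e * b + f))^2 * (e^2 - 4 * f)"
    using normal_quartic_factorization[OF k_nz k_gt] by metis
  have "e^2 < 4 * f"
  proof (cases "k > 0")
    case True
    then show ?thesis by (rule normal_quartic_two_roots_outside[OF _ f(1-3)])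
  next
    case False
    then have "k^3 < 0" "Psi_1 x y < 0" using k_nz assms by (simp_all add: power_less_zero_eq)
    then have "0 < k^3 * Psi_1 x y" by (rule mult_neg_neg)
    moreover have "(a - b)^2 * ((a^2 + e * a + f) * (b^2 + e * b + f))^2 * (e^2 - 4 * f) = - 16 * (k^3 * Psi_1 x y)"
      unfolding f(4)[symmetric] by (rule disc)
    ultimately have "(a - b)^2 * ((a^2 + e * a + f) * (b^2 + e * b + f))^2 * (e^2 - 4 * f) < 0"
      by linarith
    then show ?thesis by (auto simp: mult_less_0_iff not_less[symmetric])
  qed
  then have "{u. normal_quartic x k u = 0} = {a, b}"
    using quadratic_pos f(3) by (auto simp: less_le)
  then show ?thesis using f by (intro that[of a b]) auto
qed

lemma normal_quartic_roots_quadruple: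
  assumes "Psi_1 x y > 0" "k < 0"
  obtains a b v w where "distinct [a, b, v, w]" "{u. normal_quartic x k u = 0} = {a, b, v, w}"
proof -
  obtain a b e f where f: "a < 0" "0 < b"
    "\<And>u. normal_quartic x k u = (u - a) * (u - b) * (u^2 + e * u + f)"
    "disc4 (- 2 * x) k (- 2 * x * k) (- (k^2 * (k + 1)))
     = (a - b)^2 * ((a^2 + e * a + f) * (b^2 + e * b + f))^2 * (e^2 - 4 * f)"
    using normal_quartic_factorization[OF k_nz k_gt] by metis
  have "k^3 * Psi_1 x y < 0" using assms by (intro mult_neg_pos) (simp_all add: power_less_zero_eq)
  moreover have "(a - b)^2 * ((a^2 + e * a + f) * (b^2 + e * b + f))^2 * (e^2 - 4 * f) = - 16 * (k^3 * Psi_1 x y)"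
    unfolding f(4)[symmetric] by (rule disc)
  ultimately have pos: "(a - b)^2 * ((a^2 + e * a + f) * (b^2 + e * b + f))^2 * (e^2 - 4 * f) > 0"
    by linarith
  then have ef: "e^2 - 4 * f > 0"
    by (smt (verit) mult_nonneg_nonpos zero_le_mult_iff zero_le_power2)
  then have "4 * f \<le> e^2" by simp
  then obtain v w where vw: "v + w = - e" "v * w = f" "(v - w)^2 = e^2 - 4 * f"
    by (rule quadratic_split)
  then have ef_eq: "e = - (v + w)" "f = v * w" by linarith+
  have q: "u^2 + e * u + f = (u - v) * (u - w)" for u unfolding ef_eq by algebra
  have "v \<noteq> w" using vw(3) ef by auto
  moreover have "a \<noteq> v" "a \<noteq> w" "b \<noteq> v" "b \<noteq> w" using pos unfolding q by auto
  moreover have "{u. normal_quartic x k u = 0} = {a, b, v, w}" unfolding f(3) q by auto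
  ultimately show ?thesis using f(1,2) by (intro that[of a b v w]) auto
qed

text \<open>A zero discriminant makes two of the four real roots coincide. A triple root is excluded
  above, and two double roots would make the quartic a square, against its negative value at
  0.\<close>

lemma normal_quartic_roots_double:
  assumes "Psi_1 x y = 0"
  obtains d a b where "distinct [d, a, b]" "\<And>u. normal_quartic x k u = (u - d)^2 * (u - a) * (u - b)"
proof -
  obtain a b e f where f: "a < 0" "0 < b"
    "\<And>u. normal_quartic x k u = (u - a) * (u - b) * (u^2 + e * u + f)"
    "disc4 (- 2 * x) k (- 2 * x * k) (- (k^2 * (k + 1)))
     = (a - b)^2 * ((a^2 + e * a + f) * (b^2 + e * b + f))^2 * (e^2 - 4 * f)"
    using normal_quartic_factorization[OF k_nz k_gt] by metis
  have z: "(a - b)^2 * ((a^2 + e * a + f) * (b^2 + e * b + f))^2 * (e^2 - 4 * f) = 0"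
    unfolding f(4)[symmetric] disc using assms by simp
  have "e^2 \<ge> 4 * f"
  proof (rule ccontr)
    assume "\<not> e^2 \<ge> 4 * f"
    then show False
      using z f(1,2) quadratic_pos[of e f a] quadratic_pos[of e f b] by auto
  qed
  then have "4 * f \<le> e^2" by simp
  then obtain v w where vw: "v + w = - e" "v * w = f" "(v - w)^2 = e^2 - 4 * f"
    by (rule quadratic_split)
  then have ef_eq: "e = - (v + w)" "f = v * w" by linarith+
  have q: "u^2 + e * u + f = (u - v) * (u - w)" for u unfolding ef_eq by algebra
  have no_triple: False if "\<And>u. normal_quartic x k u = (u - d)^3 * (u - m)" for d m
    using normal_quartic_no_triple_root[OF k_nz k_gt] that by blast
  have no_squares: False if "\<And>u. normal_quartic x k u = ((u - d) * (u - m))^2" for d m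
    using normal_quartic_0_neg[OF k_nz k_gt, of x] that[of 0] by simp
  have "a \<noteq> b" using f(1,2) by simp
  have "v = w \<or> v = a \<or> w = a \<or> v = b \<or> w = b"
    using z \<open>a \<noteq> b\<close> vw(3) unfolding q by auto
  then obtain d m n where dmn: "\<And>u. normal_quartic x k u = (u - d)^2 * (u - m) * (u - n)"
  proof (elim disjE)
    assume *: "v = w"
    show ?thesis by (rule that[of v a b]) (unfold f(3) q *, algebra)
  next
    assume *: "v = a"
    show ?thesis by (rule that[of a b w]) (unfold f(3) q *, algebra)
  next
    assume *: "w = a"
    show ?thesis by (rule that[of a b v]) (unfold f(3) q *, algebra)
  next
    assume *: "v = b"
    show ?thesis by (rule that[of b a w]) (unfold f(3) q *, algebra)
  next
    assume *: "w = b"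
    show ?thesis by (rule that[of b a v]) (unfold f(3) q *, algebra)
  qed
  have "d \<noteq> m" using no_triple[of d n] dmn by (auto simp: power3_eq_cube power2_eq_square)
  moreover have "d \<noteq> n" using no_triple[of d m] dmn by (auto simp: power3_eq_cube power2_eq_square mult_ac)
  moreover have "m \<noteq> n" using no_squares[of d m] dmn by (auto simp: power2_eq_square mult_ac)
  ultimately show ?thesis using dmn by (intro that[of d m n]) auto
qed

end

section \<open>Counting the parabolas\<close>

lemma circle_and_parabola_poly_0:
  fixes x y :: real
  assumes "x^2 + y^2 - 1 \<noteq> 0"
  shows "poly (Q7_4 x y) 0 \<noteq> 0"
  using assms by (simp add: Q7_4_def poly_monom)

lemma poncelet_parameters_7:
  fixes x y :: real
  assumes "x^2 + y^2 - 1 \<noteq> 0"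
  shows "poncelet_parameters 7 (x, y) = {p. poly (Q7_4 x y) p = 0}"
proof -
  have "p \<noteq> 0 \<and> poncelet_pair 7 (unit_circle (x, y)) (parabola p) \<longleftrightarrow> poly (Q7_4 x y) p = 0" for p
  proof (cases "p = 0")
    case True
    then show ?thesis using circle_and_parabola_poly_0[OF assms] by auto
  next
    case False
    then have "circle_and_parabola x y p" using assms by unfold_locales
    then show ?thesis using False circle_and_parabola.poncelet_pair_iff by blast
  qed
  then show ?thesis unfolding poncelet_parameters_def by simp
qed

lemma card_poncelet_parabolas: "card (poncelet_parabolas n E) = card (poncelet_parameters n E)"
  unfolding poncelet_parabolas_def
proof (rule card_image, rule inj_onI)
  fix p q assume p: "p \<in> poncelet_parameters n E" "q \<in> poncelet_parameters n E"
    and eq: "conic_points (parabola p) = conic_points (parabola q)"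
  have nz: "p \<noteq> 0" "q \<noteq> 0" using p by (simp_all add: poncelet_parameters_def)
  \<comment> \<open>The vertex of the parabola distinguishes it from all others of the
    family.\<close>
  have "affine_point (- p / 2, 0) \<in> conic_points (parabola p)"
    unfolding affine_point_in_parabola by (simp add: power2_eq_square)
  then have "q * (q - p) = 0"
    unfolding eq affine_point_in_parabola by (auto simp: power2_eq_square)
  then show "p = q" using nz by auto
qed

lemma poly_ext: "(\<And>t. poly p t = poly q t) \<Longrightarrow> p = q" for p q :: "real poly"
  using poly_eq_poly_eq_iff[of p q] by blast

lemma order_power_mult:
  fixes q :: "'a :: idom poly"
  assumes "poly q a \<noteq> 0"
  shows "order a ([:- a, 1:] ^ n * q) = n"
proof -
  have "[:- a, 1:] ^ n * q \<noteq> 0" using assms by auto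
  then show ?thesis
    using assms by (simp add: order_mult order_power_n_n order_0I)
qed

lemma Q7_4_roots:
  fixes x y :: real
  defines "r \<equiv> x^2 + y^2" and "k \<equiv> x^2 + y^2 - 1"
  assumes "r \<noteq> 0" "k \<noteq> 0"
  defines "h \<equiv> \<lambda>u. k * (u - 2 * x) / (2 * r)"
  shows "inj h" "{p. poly (Q7_4 x y) p = 0} = h ` {u. normal_quartic x k u = 0}"
    "2 * x + 2 * r * p / k - u = 2 * r / k * (p - h u)"
proof -
  show lin: "2 * x + 2 * r * p / k - u = 2 * r / k * (p - h u)" for p u
    using assms(3,4) by (simp add: h_def field_simps)
  show "inj h"
    using assms(3,4) by (auto intro!: injI simp: h_def)
  have "h (2 * x + 2 * r * p / k) = p" for p
    using lin[of p "2 * x + 2 * r * p / k"] assms(3,4) by simp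
  moreover have "2 * x + 2 * r * h u / k = u" for u
    using lin[of "h u" u] by simp
  moreover have "poly (Q7_4 x y) p = 0 \<longleftrightarrow> normal_quartic x k (2 * x + 2 * r * p / k) = 0" for p
  proof -
    have "poly (Q7_4 x y) p = k^4 / r * normal_quartic x k (2 * x + 2 * r * p / k)"
      using poly_Q7_4[of x y p] assms(3,4) unfolding r_def k_def by blast
    then show ?thesis using assms(3,4) by simp
  qed
  ultimately show "{p. poly (Q7_4 x y) p = 0} = h ` {u. normal_quartic x k u = 0}"
    by (force simp: image_iff)
qed

theorem proposition4p6:
  fixes x\<^sub>E y\<^sub>E :: real
  assumes "(x\<^sub>E, y\<^sub>E) \<notin> Sigma1"
  shows
    "((x\<^sub>E, y\<^sub>E) \<in> R1_minus \<union> S1_plus \<longrightarrow>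
        card (poncelet_parabolas 7 (x\<^sub>E, y\<^sub>E)) = 2 \<and>
        (\<exists>a b. distinct [a, b] \<and>
           poncelet_parameters 7 (x\<^sub>E, y\<^sub>E) = {a, b} \<and>
           {p. poly (Q7_4 x\<^sub>E y\<^sub>E) p = 0} = {a, b}))
   \<and> ((x\<^sub>E, y\<^sub>E) \<in> R1 \<longrightarrow>
        card (poncelet_parabolas 7 (x\<^sub>E, y\<^sub>E)) = 3 \<and>
        (\<exists>a b c. distinct [a, b, c] \<and>
           poncelet_parameters 7 (x\<^sub>E, y\<^sub>E) = {a, b, c} \<and>
           {p. poly (Q7_4 x\<^sub>E y\<^sub>E) p = 0} = {a, b, c} \<and>
           order a (Q7_4 x\<^sub>E y\<^sub>E) = 2 \<and>
           order b (Q7_4 x\<^sub>E y\<^sub>E) = 1 \<and>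
           order c (Q7_4 x\<^sub>E y\<^sub>E) = 1))
   \<and> ((x\<^sub>E, y\<^sub>E) \<in> R1_plus \<inter> S1_minus \<longrightarrow>
        card (poncelet_parabolas 7 (x\<^sub>E, y\<^sub>E)) = 4 \<and>
        (\<exists>a b c d. distinct [a, b, c, d] \<and>
           poncelet_parameters 7 (x\<^sub>E, y\<^sub>E) = {a, b, c, d} \<and>
           {p. poly (Q7_4 x\<^sub>E y\<^sub>E) p = 0} = {a, b, c, d}))"
proof -
  define x y r k where "x = x\<^sub>E" and "y = y\<^sub>E" and "r = x^2 + y^2" and "k = x^2 + y^2 - 1"
  define h where "h u = k * (u - 2 * x) / (2 * r)" for u
  have nz: "r \<noteq> 0" "k \<noteq> 0"
    using assms by (auto simp: Sigma1_def S1_def r_def k_def x_def y_def)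
  have "r \<ge> 0" "k = r - 1" by (simp_all add: r_def k_def)
  with nz(1) have k_gt: "k > - 1" by linarith
  have roots: "inj h" "{p. poly (Q7_4 x y) p = 0} = h ` {u. normal_quartic x k u = 0}"
    "\<And>p u. 2 * x + 2 * r * p / k - u = 2 * r / k * (p - h u)"
    using Q7_4_roots[of x y] nz unfolding h_def r_def k_def by blast+
  have h_eq: "h u = h v \<longleftrightarrow> u = v" for u v using roots(1) by (rule inj_eq)
  have params: "poncelet_parameters 7 (x, y) = {p. poly (Q7_4 x y) p = 0}"
    using poncelet_parameters_7 nz(2) unfolding k_def by blast
  have "card (poncelet_parabolas 7 (x, y)) = 2 \<and> (\<exists>a b. distinct [a, b] \<and>
      poncelet_parameters 7 (x, y) = {a, b} \<and> {p. poly (Q7_4 x y) p = 0} = {a, b})"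
    if "(x, y) \<in> R1_minus \<union> S1_plus"
  proof -
    have "Psi_1 x y < 0 \<or> k > 0" using that by (auto simp: R1_minus_def S1_plus_def k_def)
    then obtain a b where ab: "a \<noteq> b" "{u. normal_quartic x k u = 0} = {a, b}"
      using normal_quartic_roots_simple_pair[OF k_def nz(2) k_gt] by metis
    then have "{p. poly (Q7_4 x y) p = 0} = {h a, h b}" using roots(2) by simp
    then show ?thesis
      unfolding card_poncelet_parabolas params using ab(1) h_eq
      by (intro conjI exI[of _ "h a"] exI[of _ "h b"]) simp_all
  qed
  moreover have "card (poncelet_parabolas 7 (x, y)) = 3 \<and> (\<exists>a b c. distinct [a, b, c] \<and>
      poncelet_parameters 7 (x, y) = {a, b, c} \<and> {p. poly (Q7_4 x y) p = 0} = {a, b, c} \<and>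
      order a (Q7_4 x y) = 2 \<and> order b (Q7_4 x y) = 1 \<and> order c (Q7_4 x y) = 1)"
    if "(x, y) \<in> R1"
  proof -
    have "Psi_1 x y = 0" using that by (simp add: R1_def)
    then obtain d a b where dab: "distinct [d, a, b]"
      and G: "\<And>u. normal_quartic x k u = (u - d)^2 * (u - a) * (u - b)"
      using normal_quartic_roots_double[OF k_def nz(2) k_gt] by metis
    have ne: "d \<noteq> a" "d \<noteq> b" "a \<noteq> b" using dab by auto
    have "{u. normal_quartic x k u = 0} = {d, a, b}" unfolding G by auto
    then have set: "{p. poly (Q7_4 x y) p = 0} = {h d, h a, h b}" using roots(2) by simp
    \<comment> \<open>The leading coefficient of \<open>Q7_4\<close>: each of the four linear
      factors in u contributes 2 r / k under the affine substitution, so multiplicities carry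
      over.\<close>
    define K where "K = k^4 / r * (2 * r / k)^4"
    have K: "K \<noteq> 0" using nz by (simp add: K_def)
    have Q: "poly (Q7_4 x y) p = K * ((p - h d)^2 * (p - h a) * (p - h b))" for p
    proof -
      have "poly (Q7_4 x y) p = k^4 / r * normal_quartic x k (2 * x + 2 * r * p / k)"
        using poly_Q7_4[of x y p] nz unfolding r_def k_def by blast
      then show ?thesis unfolding G roots(3) K_def by algebra
    qed
    have Qd: "Q7_4 x y = [:- h d, 1:]^2 * smult K ([:- h a, 1:] * [:- h b, 1:])"
      and Qa: "Q7_4 x y = [:- h a, 1:]^1 * smult K ([:- h d, 1:]^2 * [:- h b, 1:])"
      and Qb: "Q7_4 x y = [:- h b, 1:]^1 * smult K ([:- h d, 1:]^2 * [:- h a, 1:])"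
      by (rule poly_ext, simp add: Q power2_eq_square algebra_simps)+
    have "order (h d) (Q7_4 x y) = 2" unfolding Qd
      by (rule order_power_mult, unfold poly_smult poly_mult poly_power) (use K ne h_eq in simp)
    moreover have "order (h a) (Q7_4 x y) = 1" unfolding Qa
      by (rule order_power_mult, unfold poly_smult poly_mult poly_power) (use K ne h_eq in simp)
    moreover have "order (h b) (Q7_4 x y) = 1" unfolding Qb
      by (rule order_power_mult, unfold poly_smult poly_mult poly_power) (use K ne h_eq in simp)
    ultimately show ?thesis
      unfolding card_poncelet_parabolas params using set ne h_eq
      by (intro conjI exI[of _ "h d"] exI[of _ "h a"] exI[of _ "h b"]) simp_all
  qed
  moreover have "card (poncelet_parabolas 7 (x, y)) = 4 \<and> (\<exists>a b c d. distinct [a, b, c, d] \<and>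
      poncelet_parameters 7 (x, y) = {a, b, c, d} \<and> {p. poly (Q7_4 x y) p = 0} = {a, b, c, d})"
    if "(x, y) \<in> R1_plus \<inter> S1_minus"
  proof -
    have "Psi_1 x y > 0" "k < 0" using that by (auto simp: R1_plus_def S1_minus_def k_def)
    then obtain a b v w where abvw: "distinct [a, b, v, w]" "{u. normal_quartic x k u = 0} = {a, b, v, w}"
      using normal_quartic_roots_quadruple[OF k_def nz(2) k_gt] by metis
    then have "{p. poly (Q7_4 x y) p = 0} = {h a, h b, h v, h w}" using roots(2) by simp
    then show ?thesis
      unfolding card_poncelet_parabolas params using abvw(1) h_eq
      by (intro conjI exI[of _ "h a"] exI[of _ "h b"] exI[of _ "h v"] exI[of _ "h w"]) simp_all
  qed
  ultimately show ?thesis unfolding x_def y_def by blast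
qed

end
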